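(* For rationals $\alpha \in (1,\infty)$ and $\beta \in (0,1/2)$, $$\mathrm{COMPLEX}(\lambda n.\, n - \alpha \sqrt{n}\log_2 n) \leq_{\mathrm{w}} \mathrm{LUA}(\lambda n.\, (\log_2 n)^\beta).$$ More generally, if $q \colon \mathbb{N} \to \mathbb{N}$ is an order function such that, for some $\epsilon>0$, $q(2^{(3/2+\epsilon)n^2}) \leq n+1$ for almost all $n$, then $\mathrm{COMPLEX}(\lambda n.\, n - \alpha \sqrt{n}\log_2 n) \leq_{\mathrm{w}} \mathrm{LUA}(q)$.
   Context: "Almost all" means all but finitely many. An order function is a computable (i.e. its values are uniformly computable reals), nondecreasing, unbounded function $\mathbb{N}\to\mathbb{R}$. An order function evaluated at a nonnegative real argument is understood via its piecewise linear extension, $q(x)=(q(\lfloor x\rfloor+1)-q(\lfloor x\rfloor))(x-\lfloor x\rfloor)+q(\lfloor x\rfloor)$. Prefix-free complexity: a prefix-free machine is a partial recursive $M$ from $\{0,1\}^*$ to $\{0,1\}^*$ with prefix-free domain; $U$ is universal if for each prefix-free machine $M$ there is $\rho$ with $U(\rho^\frown\tau)\simeq M(\tau)$ for all $\tau$. Fix a universal $U$ and let $K(\sigma)=\min\{|\tau| : U(\tau)=\sigma\}$. For $f\colon\mathbb{N}\to\mathbb{R}$, $\mathrm{COMPLEX}(f)$ is the set of $X\in\{0,1\}^{\mathbb{N}}$ for which there is $c\in\mathbb{N}$ with $K(X\upharpoonright n)\geq f(n)-c$ for all $n$ (finitely many values of $f$ are irrelevant and may be redefined if undefined). A partial recursive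 $\psi\colon\subseteq\mathbb{N}\to\mathbb{N}$ is linearly universal if for every partial recursive $\theta\colon\subseteq\mathbb{N}\to\mathbb{N}$ there are $a,b\in\mathbb{N}$ with $\psi(ax+b)\simeq\theta(x)$ for all $x$. For $p\colon\mathbb{N}\to(1,\infty)$, $\mathrm{LUA}(p)$ is the set of $X\in\mathbb{N}^{\mathbb{N}}$ such that $X(n)<p(n)$ for all $n$ and, for some linearly universal partial recursive $\psi$, there is no $n\in\operatorname{dom}\psi$ with $X(n)=\psi(n)$. Convention: if $p$ is only a partial function into $\mathbb{R}$ (or takes values $\le 1$ at finitely many places), but its restriction to $\{n\ge a\}$ is total, computable, nondecreasing, unbounded with values in $(1,\infty)$ for some $a$, then $\mathrm{LUA}(p)$ means $\mathrm{LUA}(\tilde p)$ where $\tilde p(n)=p(n)$ for $n\geq a$ and $\tilde p(n)=p(a)$ for $n<a$ (different $a$ give weakly equivalent classes). For $P,Q\subseteq\mathbb{N}^{\mathbb{N}}$, $P\leq_{\mathrm{w}}Q$ means every $Y\in Q$ Turing-computes some $X\in P$. *)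

theory Defs
  imports Complex_Main "HOL-Library.Nat_Bijection" "HOL-Library.Sublist"
begin

section \<open>Partial recursive functions relative to an oracle\<close>

text \<open>
  Kleene's schemes plus an oracle call. Arities are not tracked in the syntax; a term that is
  applied to an argument list of the wrong length has no value or ignores arguments.
\<close>

datatype recf =
    Zero
  | Succ
  | Oracle
  | Proj nat
  | Comp recf "recf list"
  | PrimRec recf recf
  | Mu recf

inductive eval :: "(nat \<Rightarrow> nat) \<Rightarrow> recf \<Rightarrow> nat list \<Rightarrow> nat \<Rightarrow> bool" for A where
  Zero: "eval A Zero xs 0"
| Succ: "eval A Succ [x] (Suc x)"
| Oracle: "eval A Oracle [x] (A x)"
| Proj: "i < length xs \<Longrightarrow> eval A (Proj i) xs (xs ! i)"
| Comp: "list_all2 (\<lambda>g y. eval A g xs y) gs ys \<Longrightarrow> eval A f ys z \<Longrightarrow> eval A (Comp f gs) xs z"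
| PrimRec_0: "eval A f xs z \<Longrightarrow> eval A (PrimRec f g) (0 # xs) z"
| PrimRec_Suc: "eval A (PrimRec f g) (n # xs) y \<Longrightarrow> eval A g (n # y # xs) z
    \<Longrightarrow> eval A (PrimRec f g) (Suc n # xs) z"
| Mu: "eval A f (n # xs) 0 \<Longrightarrow> (\<forall>m<n. \<exists>y>0. eval A f (m # xs) y) \<Longrightarrow> eval A (Mu f) xs n"

inductive_cases eval_ZeroE: "eval A Zero xs z"
inductive_cases eval_SuccE: "eval A Succ xs z"
inductive_cases eval_OracleE: "eval A Oracle xs z"
inductive_cases eval_ProjE: "eval A (Proj i) xs z"
inductive_cases eval_CompE: "eval A (Comp f gs) xs z"
inductive_cases eval_PrimRec_0E: "eval A (PrimRec f g) (0 # xs) z"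
inductive_cases eval_PrimRec_SucE: "eval A (PrimRec f g) (Suc n # xs) z"
inductive_cases eval_MuE: "eval A (Mu f) xs z"

lemma eval_deterministic: "eval A p xs y \<Longrightarrow> eval A p xs z \<Longrightarrow> y = z"
proof (induction arbitrary: z rule: eval.induct)
  case (Zero xs)
  then show ?case by (rule eval_ZeroE) simp
next
  case (Succ x)
  then show ?case by (rule eval_SuccE) simp
next
  case (Oracle x)
  then show ?case by (rule eval_OracleE) simp
next
  case (Proj i xs)
  from Proj.prems show ?case by (rule eval_ProjE) simp
next
  case (Comp xs gs ys f z')
  from Comp.prems obtain ys' where ys': "list_all2 (\<lambda>g y. eval A g xs y) gs ys'" "eval A f ys' z"
    by (rule eval_CompE)
  have len: "length gs = length ys" "length gs = length ys'"
    using list_all2_lengthD[OF Comp.IH(1)] list_all2_lengthD[OF ys'(1)] by simp_all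
  have "ys = ys'"
  proof (rule nth_equalityI)
    show "length ys = length ys'" using len by simp
    fix i assume "i < length ys"
    with len have i: "i < length gs" by simp
    from list_all2_nthD[OF Comp.IH(1) i] list_all2_nthD[OF ys'(1) i]
    show "ys ! i = ys' ! i" by simp
  qed
  with ys'(2) have "eval A f ys z" by simp
  then show ?case by (rule Comp.IH(2))
next
  case (PrimRec_0 f xs z' g)
  from PrimRec_0.prems have "eval A f xs z" by (rule eval_PrimRec_0E)
  then show ?case by (rule PrimRec_0.IH)
next
  case (PrimRec_Suc f g n xs y z')
  from PrimRec_Suc.prems obtain y' where
    y': "eval A (PrimRec f g) (n # xs) y'" "eval A g (n # y' # xs) z"
    by (rule eval_PrimRec_SucE)
  from PrimRec_Suc.IH(1)[OF y'(1)] y'(2) have "eval A g (n # y # xs) z" by simp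
  then show ?case by (rule PrimRec_Suc.IH(2))
next
  case (Mu f n xs)
  from Mu.prems have z1: "eval A f (z # xs) 0" by (rule eval_MuE)
  from Mu.prems have z2: "\<forall>m<z. \<exists>y>0. eval A f (m # xs) y" by (rule eval_MuE)
  show ?case
  proof (rule linorder_cases[of n z])
    assume "n < z"
    with z2 obtain y where "0 < y" "eval A f (n # xs) y" by blast
    with Mu.IH(1)[of y] show ?thesis by simp
  next
    assume "z < n"
    with Mu.IH(2) obtain y where y: "0 < y" "\<And>x. eval A f (z # xs) x \<Longrightarrow> y = x" by blast
    from y(2)[OF z1] y(1) show ?thesis by simp
  qed
qed

definition recursive_in :: "(nat \<Rightarrow> nat) \<Rightarrow> (nat \<Rightarrow> nat) \<Rightarrow> bool" where
  "recursive_in A f \<longleftrightarrow> (\<exists>p. \<forall>x y. eval A p [x] y \<longleftrightarrow> y = f x)"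

text \<open>Absence of an oracle is rendered as the constant zero oracle.\<close>

definition recursive :: "(nat \<Rightarrow> nat) \<Rightarrow> bool" where
  "recursive f \<longleftrightarrow> recursive_in (\<lambda>_. 0) f"

definition partial_recursive :: "(nat \<rightharpoonup> nat) \<Rightarrow> bool" where
  "partial_recursive \<theta> \<longleftrightarrow> (\<exists>p. \<forall>x y. eval (\<lambda>_. 0) p [x] y \<longleftrightarrow> \<theta> x = Some y)"

definition weakly_reducible :: "(nat \<Rightarrow> nat) set \<Rightarrow> (nat \<Rightarrow> nat) set \<Rightarrow> bool" (infix "\<le>\<^sub>w" 50) where
  "P \<le>\<^sub>w Q \<longleftrightarrow> (\<forall>Y\<in>Q. \<exists>X\<in>P. recursive_in Y X)"

section \<open>Order functions\<close>

definition rational_of_code :: "nat \<Rightarrow> real" where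
  "rational_of_code m = (case prod_decode m of (i, d) \<Rightarrow> of_int (int_decode i) / of_nat (Suc d))"

definition uniformly_computable :: "(nat \<Rightarrow> real) \<Rightarrow> bool" where
  "uniformly_computable f \<longleftrightarrow>
     (\<exists>h. recursive h \<and> (\<forall>n k. \<bar>f n - rational_of_code (h (prod_encode (n, k)))\<bar> \<le> 1 / 2 ^ k))"

definition order_function :: "(nat \<Rightarrow> real) \<Rightarrow> bool" where
  "order_function q \<longleftrightarrow> uniformly_computable q \<and> mono q \<and> (\<forall>B. \<exists>n. B < q n)"

text \<open>Only meant for nonnegative arguments.\<close>

definition piecewise_linear :: "(nat \<Rightarrow> real) \<Rightarrow> real \<Rightarrow> real" where
  "piecewise_linear q x =
     (q (nat \<lfloor>x\<rfloor> + 1) - q (nat \<lfloor>x\<rfloor>)) * (x - of_int \<lfloor>x\<rfloor>) + q (nat \<lfloor>x\<rfloor>)"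

section \<open>Prefix-free complexity\<close>

text \<open>The bijective base-2 numeration of binary strings, least significant digit first.\<close>

fun string_code :: "bool list \<Rightarrow> nat" where
  "string_code [] = 0"
| "string_code (b # \<sigma>) = 2 * string_code \<sigma> + (if b then 2 else 1)"

definition partial_recursive_string :: "(bool list \<rightharpoonup> bool list) \<Rightarrow> bool" where
  "partial_recursive_string M \<longleftrightarrow>
     (\<exists>\<theta>. partial_recursive \<theta> \<and> (\<forall>\<sigma>. \<theta> (string_code \<sigma>) = map_option string_code (M \<sigma>)))"

definition prefix_free_machine :: "(bool list \<rightharpoonup> bool list) \<Rightarrow> bool" where
  "prefix_free_machine M \<longleftrightarrow> partial_recursive_string M \<and>
     (\<forall>\<sigma>\<in>dom M. \<forall>\<tau>\<in>dom M. prefix \<sigma> \<tau> \<longrightarrow> \<sigma> = \<tau>)"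

definition universal_prefix_free_machine :: "(bool list \<rightharpoonup> bool list) \<Rightarrow> bool" where
  "universal_prefix_free_machine U \<longleftrightarrow> prefix_free_machine U \<and>
     (\<forall>M. prefix_free_machine M \<longrightarrow> (\<exists>\<rho>. \<forall>\<tau>. U (\<rho> @ \<tau>) = M \<tau>))"

definition K :: "(bool list \<rightharpoonup> bool list) \<Rightarrow> bool list \<Rightarrow> nat" where
  "K U \<sigma> = (LEAST k. \<exists>\<tau>. U \<tau> = Some \<sigma> \<and> length \<tau> = k)"

text \<open>Elements of Cantor space are identified with the 0-1-valued functions in Baire space.\<close>

definition COMPLEX :: "(bool list \<rightharpoonup> bool list) \<Rightarrow> (nat \<Rightarrow> real) \<Rightarrow> (nat \<Rightarrow> nat) set" where
  "COMPLEX U f = {(\<lambda>n. of_bool (X n)) | X :: nat \<Rightarrow> bool.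
     \<exists>c::nat. \<forall>n. real (K U (map X [0..<n])) \<ge> f n - real c}"

section \<open>Linearly universal avoidance\<close>

definition linearly_universal :: "(nat \<rightharpoonup> nat) \<Rightarrow> bool" where
  "linearly_universal \<psi> \<longleftrightarrow> partial_recursive \<psi> \<and>
     (\<forall>\<theta>. partial_recursive \<theta> \<longrightarrow> (\<exists>a b. \<forall>x. \<psi> (a * x + b) = \<theta> x))"

text \<open>Only meant for functions \<open>p\<close> all of whose values are greater than 1.\<close>

definition LUA :: "(nat \<Rightarrow> real) \<Rightarrow> (nat \<Rightarrow> nat) set" where
  "LUA p = {X. (\<forall>n. real (X n) < p n) \<and>
     (\<exists>\<psi>. linearly_universal \<psi> \<and> \<not> (\<exists>n\<in>dom \<psi>. \<psi> n = Some (X n)))}"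

text \<open>
  If \<open>p\<close> is undefined or at most 1 at some places below \<open>a\<close>, then its avoidance class is understood
  to be the one of the function below. The choice of \<open>a\<close> does not matter up to weak equivalence.
\<close>

definition constant_below :: "nat \<Rightarrow> (nat \<Rightarrow> real) \<Rightarrow> nat \<Rightarrow> real" where
  "constant_below a p n = (if a \<le> n then p n else p a)"

end

theory Submission
  imports Defs "HOL-Real_Asymp.Real_Asymp"
begin

text \<open>
  The sequence is built in blocks, the \<open>n\<close>-th one having length \<open>n + 1\<close>, so that the first
  \<open>n\<close> blocks have \<open>n (n + 1) / 2\<close> bits. Every halting computation \<open>U(\<tau>) = \<sigma>\<close> contributes the
  measure \<open>2\<^sup>-\<^sup>|\<^sup>\<tau>\<^sup>|\<close>, spread uniformly over the cylinder of \<open>\<sigma>\<close>; by Kraft's inequality the total is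
  at most 1. A node consisting of \<open>n\<close> blocks is light if its measure stays below
  \<open>2 n\<^sup>n / 2\<^sup>l\<close>, where \<open>l\<close> is its length. Prefixes of light nodes have complexity greater than
  their length minus \<open>n log n + 1\<close>, and \<open>n log n\<close> is about \<open>\<surd>m log m / \<surd>2\<close> at length \<open>m\<close>.

  Fewer than \<open>2\<^sup>n\<^sup>+\<^sup>1 / (n + 1)\<close> of the \<open>2\<^sup>n\<^sup>+\<^sup>1\<close> children of a light node fail to be light, and these are
  enumerable as \<open>e\<^sub>0, e\<^sub>1, \<dots>\<close>. For every rank \<open>i\<close> and every \<open>(n + 1)\<close>-tuple \<open>T\<close> of blocks, an oracle
  with values at most \<open>n\<close> that avoids the position of \<open>e\<^sub>i\<close> in \<open>T\<close> excludes one entry of \<open>T\<close> from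
  being \<open>e\<^sub>i\<close>; hence at most \<open>n\<close> blocks are not excluded for rank \<open>i\<close>, and some block is excluded for all
  ranks. A query \<open>(n, node, i, T)\<close> takes \<open>n\<^sup>2 / 2 + n\<^sup>2 + O(n)\<close> bits, which is where \<open>3/2\<close> comes from.
\<close>

section \<open>Computable functions\<close>

text \<open>Only the value is demanded; uniqueness is left to determinism of \<open>eval\<close>.
  Arguments form one list of length \<open>k\<close>, so that one set of closure rules serves all
  arities.\<close>

definition computable :: "(nat \<Rightarrow> nat) \<Rightarrow> nat \<Rightarrow> (nat list \<Rightarrow> nat) \<Rightarrow> bool" where
  "computable A k F \<longleftrightarrow> (\<exists>p. \<forall>xs. length xs = k \<longrightarrow> eval A p xs (F xs))"

named_theorems computable_intros

lemma computable_cong: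
  assumes "\<And>xs. length xs = k \<Longrightarrow> F xs = G xs"
  shows "computable A k F \<longleftrightarrow> computable A k G"
  using assms unfolding computable_def by metis

lemma computable_nth [computable_intros]:
  assumes "i < k"
  shows "computable A k (\<lambda>xs. xs ! i)"
  unfolding computable_def using assms eval.Proj by metis

text \<open>Sums, searches and recursions put bound variables in front of the argument list and see
  the parameters as \<open>drop 1 xs\<close> or \<open>drop 2 xs\<close>; this rule and the next
  reach parameters beneath one and two such binders.\<close>

lemma computable_drop_nth [computable_intros]:
  assumes "j + i < k"
  shows "computable A k (\<lambda>xs. drop j xs ! i)"
proof -
  have "computable A k (\<lambda>xs. xs ! (j + i))"
    using assms by (rule computable_nth)
  then show ?thesis
    by (rule computable_cong[THEN iffD1, rotated]) (use assms in simp)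
qed

lemma computable_drop_drop_nth [computable_intros]:
  assumes "i + j + l < k"
  shows "computable A k (\<lambda>xs. drop i (drop j xs) ! l)"
  unfolding drop_drop using assms by (rule computable_drop_nth)

lemma computable_comp:
  assumes G: "computable A (length Fs) G" and Fs: "\<forall>F\<in>set Fs. computable A k F"
  shows "computable A k (\<lambda>xs. G (map (\<lambda>F. F xs) Fs))"
proof -
  obtain p where p: "\<And>ys. length ys = length Fs \<Longrightarrow> eval A p ys (G ys)"
    using G unfolding computable_def by blast
  have "\<forall>F\<in>set Fs. \<exists>q. \<forall>xs. length xs = k \<longrightarrow> eval A q xs (F xs)"
    using Fs unfolding computable_def .
  then obtain q where q: "\<And>F xs. F \<in> set Fs \<Longrightarrow> length xs = k \<Longrightarrow> eval A (q F) xs (F xs)"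
    by metis
  have "eval A (Comp p (map q Fs)) xs (G (map (\<lambda>F. F xs) Fs))" if "length xs = k" for xs
  proof (rule eval.Comp)
    show "list_all2 (\<lambda>g y. eval A g xs y) (map q Fs) (map (\<lambda>F. F xs) Fs)"
      using q that by (simp add: list_all2_conv_all_nth)
    show "eval A p (map (\<lambda>F. F xs) Fs) (G (map (\<lambda>F. F xs) Fs))"
      by (simp add: p)
  qed
  then show ?thesis unfolding computable_def by blast
qed

lemma computable_comp1:
  assumes "computable A 1 (\<lambda>xs. g (xs ! 0))" "computable A k F"
  shows "computable A k (\<lambda>xs. g (F xs))"
  using computable_comp[of A "[F]" "\<lambda>xs. g (xs ! 0)" k] assms by simp

lemma computable_comp2:
  assumes "computable A 2 (\<lambda>xs. g (xs ! 0) (xs ! 1))" "computable A k F1" "computable A k F2"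
  shows "computable A k (\<lambda>xs. g (F1 xs) (F2 xs))"
  using computable_comp[of A "[F1, F2]" "\<lambda>xs. g (xs ! 0) (xs ! 1)" k] assms
  by (simp add: numeral_2_eq_2)

lemma computable_comp3:
  assumes "computable A 3 (\<lambda>xs. g (xs ! 0) (xs ! 1) (xs ! 2))"
    "computable A k F1" "computable A k F2" "computable A k F3"
  shows "computable A k (\<lambda>xs. g (F1 xs) (F2 xs) (F3 xs))"
  using computable_comp[of A "[F1, F2, F3]" "\<lambda>xs. g (xs ! 0) (xs ! 1) (xs ! 2)" k] assms
  by (simp add: numeral_3_eq_3)

lemma computable_Suc [computable_intros]:
  assumes "computable A k F"
  shows "computable A k (\<lambda>xs. Suc (F xs))"
proof (rule computable_comp1[OF _ assms])
  have "eval A Succ xs (Suc (xs ! 0))" if "length xs = 1" for xs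
    using that eval.Succ by (cases xs) auto
  then show "computable A 1 (\<lambda>xs. Suc (xs ! 0))"
    unfolding computable_def by blast
qed

lemma computable_oracle:
  assumes "computable A k F"
  shows "computable A k (\<lambda>xs. A (F xs))"
proof (rule computable_comp1[OF _ assms])
  have "eval A Oracle xs (A (xs ! 0))" if "length xs = 1" for xs
    using that eval.Oracle by (cases xs) auto
  then show "computable A 1 (\<lambda>xs. A (xs ! 0))"
    unfolding computable_def by blast
qed

lemma computable_const [computable_intros]: "computable A k (\<lambda>_. c)"
proof (induction c)
  case 0
  show ?case unfolding computable_def using eval.Zero by blast
next
  case (Suc c)
  then show ?case by (rule computable_Suc)
qed

lemma computable_rec_nat [computable_intros]:
  assumes a: "computable A k a"
    and G: "computable A (Suc (Suc k)) (\<lambda>xs. G (xs ! 0) (xs ! 1) (drop 2 xs))"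
    and n: "computable A k n"
  shows "computable A k (\<lambda>xs. rec_nat (a xs) (\<lambda>i r. G i r xs) (n xs))"
proof -
  obtain p where p: "\<And>xs. length xs = k \<Longrightarrow> eval A p xs (a xs)"
    using a unfolding computable_def by blast
  obtain q where q: "\<And>xs. length xs = Suc (Suc k) \<Longrightarrow> eval A q xs (G (xs ! 0) (xs ! 1) (drop 2 xs))"
    using G unfolding computable_def by blast
  have q': "eval A q (i # r # xs) (G i r xs)" if "length xs = k" for i r xs
    using q[of "i # r # xs"] that by simp
  have "eval A (PrimRec p q) (m # xs) (rec_nat (a xs) (\<lambda>i r. G i r xs) m)"
    if "length xs = k" for m xs
    by (induction m) (auto intro: eval.PrimRec_0 eval.PrimRec_Suc p q' that)
  then have "eval A (PrimRec p q) xs (rec_nat (a (tl xs)) (\<lambda>i r. G i r (tl xs)) (xs ! 0))"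
    if "length xs = Suc k" for xs
    using that by (cases xs) auto
  then have rec: "computable A (Suc k) (\<lambda>xs. rec_nat (a (tl xs)) (\<lambda>i r. G i r (tl xs)) (xs ! 0))"
    unfolding computable_def by blast
  \<comment> \<open>\<open>PrimRec\<close> recurses on the head of its list; composing with
    \<open>n\<close> and the projections supplies that head and restores the parameters behind
    it.\<close>
  let ?Fs = "n # map (\<lambda>i xs. xs ! i) [0..<k]"
  have "computable A k (\<lambda>xs. rec_nat (a (tl (map (\<lambda>F. F xs) ?Fs)))
      (\<lambda>i r. G i r (tl (map (\<lambda>F. F xs) ?Fs))) (map (\<lambda>F. F xs) ?Fs ! 0))"
    by (rule computable_comp[where G = "\<lambda>xs. rec_nat (a (tl xs)) (\<lambda>i r. G i r (tl xs)) (xs ! 0)"])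
      (use rec n in \<open>auto intro: computable_nth\<close>)
  moreover have "map ((\<lambda>F. F xs) \<circ> (\<lambda>i xs. xs ! i)) [0..<k] = xs"
    if "length xs = k" for xs :: "nat list"
    using that by (intro nth_equalityI) auto
  ultimately show ?thesis
    by (subst (asm) computable_cong[where G = "\<lambda>xs. rec_nat (a xs) (\<lambda>i r. G i r xs) (n xs)"]) auto
qed

lemma computable_add [computable_intros]:
  assumes "computable A k f" "computable A k g"
  shows "computable A k (\<lambda>xs. f xs + g xs)"
proof (rule computable_comp2[OF _ assms])
  have "n + m = rec_nat m (\<lambda>i r. Suc r) n" for n m :: nat
    by (induction n) auto
  then show "computable A 2 (\<lambda>xs. xs ! 0 + xs ! 1)"
    by (simp only:) (intro computable_intros; simp)
qed

lemma computable_diff [computable_intros]: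
  assumes "computable A k f" "computable A k g"
  shows "computable A k (\<lambda>xs. f xs - g xs)"
proof -
  have "n - 1 = rec_nat 0 (\<lambda>i r. i) n" for n :: nat
    by (cases n) auto
  then have pred: "computable A k (\<lambda>xs. h xs - 1)" if "computable A k h" for k h
    by (simp only:) (intro computable_intros that; simp)
  have "m - n = rec_nat m (\<lambda>i r. r - 1) n" for n m :: nat
    by (induction n) auto
  then have "(\<lambda>xs. xs ! 0 - xs ! 1) = (\<lambda>xs. rec_nat (xs ! 0) (\<lambda>i r. r - 1) (xs ! 1 :: nat))"
    by blast
  moreover have "computable A 2 (\<lambda>xs. rec_nat (xs ! 0) (\<lambda>i r. r - 1) (xs ! 1))"
    by (intro computable_intros pred; simp)
  ultimately have "computable A 2 (\<lambda>xs. xs ! 0 - xs ! 1)"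
    by simp
  from computable_comp2[OF this assms] show ?thesis .
qed

lemma computable_mult [computable_intros]:
  assumes "computable A k f" "computable A k g"
  shows "computable A k (\<lambda>xs. f xs * g xs)"
proof (rule computable_comp2[OF _ assms])
  have "n * m = rec_nat 0 (\<lambda>i r. r + m) n" for n m :: nat
    by (induction n) auto
  then show "computable A 2 (\<lambda>xs. xs ! 0 * xs ! 1)"
    by (simp only:) (intro computable_intros; simp)
qed

lemma computable_power [computable_intros]:
  assumes "computable A k f" "computable A k g"
  shows "computable A k (\<lambda>xs. f xs ^ g xs)"
proof (rule computable_comp2[OF _ assms])
  have "m ^ n = rec_nat 1 (\<lambda>i r. r * m) n" for n m :: nat
    by (induction n) auto
  then show "computable A 2 (\<lambda>xs. xs ! 0 ^ xs ! 1)"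
    by (simp only:) (intro computable_intros; simp)
qed

lemma computable_sum [computable_intros]:
  assumes F: "computable A (Suc k) (\<lambda>xs. F (xs ! 0) (drop 1 xs))" and n: "computable A k n"
  shows "computable A k (\<lambda>xs. \<Sum>i<n xs. F i xs)"
proof -
  have "(\<Sum>i<m. F i xs) = rec_nat 0 (\<lambda>i r. r + F i xs) m" for m xs
    by (induction m) auto
  moreover have "computable A (Suc (Suc k)) (\<lambda>xs. F (xs ! 0) (drop 2 xs))"
  proof -
    \<comment> \<open>In the recursion step index 1 holds the partial sum; these projections skip
      it.\<close>
    let ?Fs = "map (\<lambda>i xs. xs ! i) (0 # [2..<Suc (Suc k)])"
    have "computable A (Suc (Suc k)) (\<lambda>xs. F (map (\<lambda>F. F xs) ?Fs ! 0) (drop 1 (map (\<lambda>F. F xs) ?Fs)))"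
      by (rule computable_comp[where G = "\<lambda>xs. F (xs ! 0) (drop 1 xs)"])
        (use F in \<open>auto intro: computable_nth simp del: upt_Suc\<close>)
    moreover have "map ((\<lambda>F. F xs) \<circ> (\<lambda>i xs. xs ! i)) [2..<Suc (Suc k)] = drop 2 xs"
      if "length xs = Suc (Suc k)" for xs :: "nat list"
      using that by (intro nth_equalityI) (auto simp del: upt_Suc)
    ultimately show ?thesis
      by (subst (asm) computable_cong[where G = "\<lambda>xs. F (xs ! 0) (drop 2 xs)"]) (auto simp del: upt_Suc)
  qed
  ultimately show ?thesis
    by (simp only:) (intro computable_intros n; simp)
qed

section \<open>Decidable predicates and unbounded search\<close>

abbreviation decidable :: "(nat \<Rightarrow> nat) \<Rightarrow> nat \<Rightarrow> (nat list \<Rightarrow> bool) \<Rightarrow> bool" where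
  "decidable A k P \<equiv> computable A k (\<lambda>xs. of_bool (P xs))"

lemma decidable_not [computable_intros]:
  assumes "decidable A k P"
  shows "decidable A k (\<lambda>xs. \<not> P xs)"
proof -
  have "of_bool (\<not> P xs) = 1 - (of_bool (P xs) :: nat)" for xs
    by simp
  then show ?thesis
    by (simp only:) (intro computable_intros assms)
qed

lemma decidable_conj [computable_intros]:
  assumes "decidable A k P" "decidable A k Q"
  shows "decidable A k (\<lambda>xs. P xs \<and> Q xs)"
  using computable_mult[OF assms] by (simp add: of_bool_conj)

lemma decidable_disj [computable_intros]:
  assumes "decidable A k P" "decidable A k Q"
  shows "decidable A k (\<lambda>xs. P xs \<or> Q xs)"
  using decidable_not[OF decidable_conj[OF assms[THEN decidable_not]]] by simp

lemma decidable_le [computable_intros]: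
  assumes "computable A k f" "computable A k g"
  shows "decidable A k (\<lambda>xs. f xs \<le> g xs)"
proof -
  have "of_bool (f xs \<le> g xs) = 1 - (f xs - g xs)" for xs
    by auto
  then show ?thesis
    by (simp only:) (intro computable_intros assms)
qed

lemma decidable_less [computable_intros]:
  assumes "computable A k f" "computable A k g"
  shows "decidable A k (\<lambda>xs. f xs < g xs)"
  unfolding less_eq_Suc_le by (intro computable_intros assms)

lemma decidable_eq [computable_intros]:
  assumes "computable A k f" "computable A k g"
  shows "decidable A k (\<lambda>xs. f xs = g xs)"
  unfolding order_eq_iff by (intro computable_intros assms)

lemma computable_if [computable_intros]:
  assumes "decidable A k P" "computable A k f" "computable A k g"
  shows "computable A k (\<lambda>xs. if P xs then f xs else g xs)"
proof -
  have "(if P xs then f xs else g xs) = of_bool (P xs) * f xs + of_bool (\<not> P xs) * g xs" for xs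
    by simp
  then show ?thesis
    by (simp only:) (intro computable_intros assms)
qed

lemma decidable_all_less [computable_intros]:
  assumes "decidable A (Suc k) (\<lambda>xs. P (xs ! 0) (drop 1 xs))" "computable A k n"
  shows "decidable A k (\<lambda>xs. \<forall>i<n xs. P i xs)"
proof -
  have "(\<forall>i<n xs. P i xs) \<longleftrightarrow> (\<Sum>i<n xs. of_bool (\<not> P i xs)) = (0::nat)" for xs
    by auto
  then show ?thesis
    by (simp only:) (intro computable_intros assms)
qed

lemma decidable_ex_less [computable_intros]:
  assumes "decidable A (Suc k) (\<lambda>xs. P (xs ! 0) (drop 1 xs))" "computable A k n"
  shows "decidable A k (\<lambda>xs. \<exists>i<n xs. P i xs)"
proof -
  have "(\<exists>i<n xs. P i xs) \<longleftrightarrow> \<not> (\<forall>i<n xs. \<not> P i xs)" for xs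
    by auto
  then show ?thesis
    by (simp only:) (intro computable_intros assms)
qed

lemma eval_Mu_Least:
  assumes p: "\<And>n. eval A p (n # xs) (of_bool (\<not> P n))" and "P n"
  shows "eval A (Mu p) xs (LEAST n. P n)"
proof (rule eval.Mu)
  show "eval A p ((LEAST n. P n) # xs) 0"
    using p[of "LEAST n. P n"] LeastI[of P, OF \<open>P n\<close>] by simp
  show "\<forall>m<LEAST n. P n. \<exists>y>0. eval A p (m # xs) y"
  proof (intro allI impI)
    fix m assume "m < (LEAST n. P n)"
    then have "\<not> P m" by (rule not_less_Least)
    with p[of m] show "\<exists>y>0. eval A p (m # xs) y" by auto
  qed
qed

text \<open>The search must succeed on every argument list. Hence several predicates searched for
  below carry an escape disjunct, such as \<open>n = 0\<close> or
  \<open>2 ^ Suc n \<le> t\<close>.\<close>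

lemma computable_Least [computable_intros]:
  assumes P: "decidable A (Suc k) (\<lambda>xs. P (xs ! 0) (drop 1 xs))"
    and ex: "\<And>xs. \<exists>n. P n xs"
  shows "computable A k (\<lambda>xs. LEAST n. P n xs)"
proof -
  obtain p where p: "\<And>xs. length xs = Suc k \<Longrightarrow> eval A p xs (of_bool (\<not> P (xs ! 0) (drop 1 xs)))"
    using decidable_not[OF P] unfolding computable_def by blast
  have "eval A (Mu p) xs (LEAST n. P n xs)" if "length xs = k" for xs
  proof -
    obtain n where "P n xs" using ex by blast
    show ?thesis
    proof (rule eval_Mu_Least)
      show "eval A p (n # xs) (of_bool (\<not> P n xs))" for n
        using p[of "n # xs"] that by simp
    qed fact
  qed
  then show ?thesis unfolding computable_def by blast
qed

lemma recursive_in_if_computable: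
  assumes "computable A 1 (\<lambda>xs. f (xs ! 0))"
  shows "recursive_in A f"
proof -
  obtain p where p: "\<And>xs. length xs = 1 \<Longrightarrow> eval A p xs (f (xs ! 0))"
    using assms unfolding computable_def by blast
  have "eval A p [x] y \<longleftrightarrow> y = f x" for x y
    using p[of "[x]"] eval_deterministic[of A p "[x]"] by auto
  then show ?thesis unfolding recursive_in_def by blast
qed

text \<open>Minimisation over a total test diverges exactly when there is no witness. The diagonal
  function and the unary machine below both have this form.\<close>

lemma partial_recursive_search:
  assumes P: "decidable (\<lambda>_. 0) 2 (\<lambda>xs. P (xs ! 0) (xs ! 1))"
    and F: "computable (\<lambda>_. 0) 2 (\<lambda>xs. F (xs ! 0) (xs ! 1))"
  shows "partial_recursive (\<lambda>x. if \<exists>u. P u x then Some (F (LEAST u. P u x) x) else None)"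
proof -
  let ?O = "\<lambda>_::nat. 0::nat"
  obtain p where p: "\<And>xs. length xs = 2 \<Longrightarrow> eval ?O p xs (of_bool (\<not> P (xs ! 0) (xs ! 1)))"
    using decidable_not[OF P] unfolding computable_def by blast
  obtain q where q: "\<And>xs. length xs = 2 \<Longrightarrow> eval ?O q xs (F (xs ! 0) (xs ! 1))"
    using F unfolding computable_def by blast
  let ?r = "Comp q [Mu p, Proj 0]"
  have p': "eval ?O p (u # [x]) (of_bool (\<not> P u x))" for u x
    using p[of "[u, x]"] by simp
  have result: "eval ?O ?r [x] (F (LEAST u. P u x) x)" if "P u x" for u x
  proof (rule eval.Comp)
    show "list_all2 (\<lambda>g y. eval ?O g [x] y) [Mu p, Proj 0] [LEAST u. P u x, x]"
      using eval_Mu_Least[of ?O p "[x]" "\<lambda>u. P u x", OF p' that] eval.Proj[of 0 "[x]" ?O] by simp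
    show "eval ?O q [LEAST u. P u x, x] (F (LEAST u. P u x) x)"
      using q[of "[LEAST u. P u x, x]"] by simp
  qed
  have "eval ?O ?r [x] y \<longleftrightarrow> (if \<exists>u. P u x then Some (F (LEAST u. P u x) x) else None) = Some y" for x y
  proof (cases "\<exists>u. P u x")
    case True
    then show ?thesis using result eval_deterministic[of ?O ?r "[x]"] by auto
  next
    case False
    have "\<not> eval ?O (Mu p) [x] u" for u
    proof
      assume "eval ?O (Mu p) [x] u"
      then have "eval ?O p (u # [x]) 0" by (rule eval_MuE)
      with p'[of u x] show False using eval_deterministic False by fastforce
    qed
    then have "\<not> eval ?O ?r [x] y"
      by (auto elim!: eval_CompE simp: list_all2_Cons1)
    with False show ?thesis by simp
  qed
  then show ?thesis unfolding partial_recursive_def by blast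
qed

section \<open>Computations in stages\<close>

text \<open>The value \<open>Suc y\<close> means that the computation yields \<open>y\<close> with all unbounded searches stopped at
  \<open>s\<close>, and \<open>0\<close> that it does not halt within this bound.\<close>

fun staged :: "(nat \<Rightarrow> nat) \<Rightarrow> recf \<Rightarrow> nat \<Rightarrow> nat list \<Rightarrow> nat" where
  "staged A Zero s xs = 1"
| "staged A Succ s xs = (if length xs = 1 then Suc (Suc (xs ! 0)) else 0)"
| "staged A Oracle s xs = (if length xs = 1 then Suc (A (xs ! 0)) else 0)"
| "staged A (Proj i) s xs = (if i < length xs then Suc (xs ! i) else 0)"
| "staged A (Comp f gs) s xs =
    (if \<exists>g\<in>set gs. staged A g s xs = 0 then 0
     else staged A f s (map (\<lambda>g. staged A g s xs - 1) gs))"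
| "staged A (PrimRec f g) s xs =
    (if xs = [] then 0
     else rec_nat (staged A f s (tl xs))
       (\<lambda>i r. if r = 0 then 0 else staged A g s (i # (r - 1) # tl xs)) (hd xs))"
| "staged A (Mu f) s xs =
    (let n = (LEAST n. s \<le> n \<or> staged A f s (n # xs) \<le> 1)
     in if n < s \<and> staged A f s (n # xs) = 1 then Suc n else 0)"

text \<open>The bounded search stops at the bound, at the first undefined value (\<open>0\<close>)
  or at the first zero (\<open>1\<close>); only the last case counts as success.\<close>

lemma staged_Mu_iff:
  "staged A (Mu f) s xs = Suc y \<longleftrightarrow>
    y < s \<and> staged A f s (y # xs) = 1 \<and> (\<forall>m<y. 1 < staged A f s (m # xs))"
proof -
  define L where "L = (LEAST n. s \<le> n \<or> staged A f s (n # xs) \<le> 1)"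
  have eq: "staged A (Mu f) s xs = (if L < s \<and> staged A f s (L # xs) = 1 then Suc L else 0)"
    by (simp add: L_def Let_def)
  have min: "1 < staged A f s (m # xs)" if "m < L" for m
    using not_less_Least that unfolding L_def by fastforce
  show ?thesis
  proof
    assume "staged A (Mu f) s xs = Suc y"
    then have "y = L" "L < s" "staged A f s (L # xs) = 1"
      unfolding eq by (auto split: if_splits)
    with min show "y < s \<and> staged A f s (y # xs) = 1 \<and> (\<forall>m<y. 1 < staged A f s (m # xs))"
      by simp
  next
    assume y: "y < s \<and> staged A f s (y # xs) = 1 \<and> (\<forall>m<y. 1 < staged A f s (m # xs))"
    have "L = y"
      unfolding L_def
    proof (rule Least_equality)
      show "y \<le> m" if "s \<le> m \<or> staged A f s (m # xs) \<le> 1" for m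
        using that y by (metis linorder_not_le order_less_le_trans less_imp_le)
    qed (use y in simp)
    with y show "staged A (Mu f) s xs = Suc y"
      unfolding eq by simp
  qed
qed

text \<open>In the case of \<open>Mu\<close>, a later stage cannot find a smaller root: all earlier
  values were already computed and positive, not merely undefined.\<close>

lemma staged_mono: "staged A p s xs = Suc y \<Longrightarrow> s \<le> s' \<Longrightarrow> staged A p s' xs = Suc y"
proof (induction p arbitrary: xs y)
  case (Comp f gs)
  have g: "\<forall>g\<in>set gs. staged A g s xs \<noteq> 0"
    and f: "staged A f s (map (\<lambda>g. staged A g s xs - 1) gs) = Suc y"
    using Comp.prems by (auto split: if_splits)
  have "\<forall>g\<in>set gs. staged A g s' xs = staged A g s xs"
    using Comp.IH(2) Comp.prems(2) g by (metis not0_implies_Suc)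
  moreover from this have "map (\<lambda>g. staged A g s' xs - 1) gs = map (\<lambda>g. staged A g s xs - 1) gs"
    by simp
  then have "staged A f s' (map (\<lambda>g. staged A g s' xs - 1) gs) = Suc y"
    using Comp.IH(1)[OF f Comp.prems(2)] by (simp only:)
  ultimately show ?case
    using g by simp
next
  case (PrimRec f g)
  then obtain n zs where xs: "xs = n # zs"
    by (cases xs) auto
  let ?h = "\<lambda>s. rec_nat (staged A f s zs) (\<lambda>i r. if r = 0 then 0 else staged A g s (i # (r - 1) # zs))"
  have "?h s n = Suc y \<Longrightarrow> ?h s' n = Suc y" for y
  proof (induction n arbitrary: y)
    case 0
    then show ?case using PrimRec.IH(1) PrimRec.prems(2) by simp
  next
    case (Suc n)
    from Suc.prems obtain r where r: "?h s n = Suc r"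
      by (cases "?h s n") auto
    with Suc show ?case
      using PrimRec.IH(2) PrimRec.prems(2) by simp
  qed
  with PrimRec.prems(1) show ?case unfolding xs by (simp cong: if_cong)
next
  case (Mu f)
  have y: "y < s" "staged A f s (y # xs) = Suc 0" "\<forall>m<y. 1 < staged A f s (m # xs)"
    using Mu.prems(1) unfolding staged_Mu_iff by auto
  have "staged A f s' (y # xs) = Suc 0"
    by (rule Mu.IH[OF y(2) Mu.prems(2)])
  moreover have "1 < staged A f s' (m # xs)" if "m < y" for m
  proof -
    have less: "1 < staged A f s (m # xs)"
      using y(3) that by blast
    then obtain r where r: "staged A f s (m # xs) = Suc r"
      by (cases "staged A f s (m # xs)") simp_all
    show ?thesis
      using less unfolding Mu.IH[OF r Mu.prems(2)] r .
  qed
  ultimately show ?case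
    using y(1) Mu.prems(2) unfolding staged_Mu_iff by simp
qed (auto split: if_splits)

lemma eval_if_staged: "staged A p s xs = Suc y \<Longrightarrow> eval A p xs y"
proof (induction p arbitrary: xs y)
  case Zero
  then show ?case using eval.Zero by simp
next
  case Succ
  then show ?case using eval.Succ by (cases xs) (auto split: if_splits)
next
  case Oracle
  then show ?case using eval.Oracle by (cases xs) (auto split: if_splits)
next
  case (Proj i)
  then show ?case using eval.Proj by (auto split: if_splits)
next
  case (Comp f gs)
  have g: "\<forall>g\<in>set gs. staged A g s xs \<noteq> 0"
    and f: "staged A f s (map (\<lambda>g. staged A g s xs - 1) gs) = Suc y"
    using Comp.prems by (auto split: if_splits)
  show ?case
  proof (rule eval.Comp)
    show "list_all2 (\<lambda>g y. eval A g xs y) gs (map (\<lambda>g. staged A g s xs - 1) gs)"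
      using Comp.IH(2) g by (simp add: list_all2_conv_all_nth)
    show "eval A f (map (\<lambda>g. staged A g s xs - 1) gs) y"
      using Comp.IH(1)[OF f] .
  qed
next
  case (PrimRec f g)
  then obtain n zs where xs: "xs = n # zs"
    by (cases xs) auto
  let ?h = "rec_nat (staged A f s zs) (\<lambda>i r. if r = 0 then 0 else staged A g s (i # (r - 1) # zs))"
  have "?h n = Suc y \<Longrightarrow> eval A (PrimRec f g) (n # zs) y" for y
  proof (induction n arbitrary: y)
    case 0
    then show ?case using PrimRec.IH(1) by (simp add: eval.PrimRec_0)
  next
    case (Suc n)
    from Suc.prems obtain r where r: "?h n = Suc r"
      by (cases "?h n") auto
    with Suc show ?case
      using PrimRec.IH(2) by (auto intro: eval.PrimRec_Suc)
  qed
  with PrimRec.prems(1) show ?case unfolding xs by (simp cong: if_cong)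
next
  case (Mu f)
  have least: "staged A f s (y # xs) = Suc 0" "\<forall>m<y. Suc 0 < staged A f s (m # xs)"
    using Mu.prems unfolding staged_Mu_iff by auto
  show ?case
  proof (rule eval.Mu)
    show "eval A f (y # xs) 0"
      using Mu.IH least(1) by simp
    show "\<forall>m<y. \<exists>z>0. eval A f (m # xs) z"
      using Mu.IH least(2) by (metis Suc_lessE)
  qed
qed

text \<open>An evaluation step has finitely many premises; by \<open>staged_mono\<close> a common
  stage beyond all of theirs serves it.\<close>

lemma staged_if_eval: "eval A p xs y \<Longrightarrow> \<exists>s. staged A p s xs = Suc y"
proof (induction rule: eval.induct)
  case (Comp xs gs ys f z)
  have "\<forall>i<length gs. \<exists>s. staged A (gs ! i) s xs = Suc (ys ! i)"
    using Comp.IH(1) by (simp add: list_all2_conv_all_nth)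
  then obtain t where t: "\<forall>i<length gs. staged A (gs ! i) (t i) xs = Suc (ys ! i)"
    by metis
  obtain t' where t': "staged A f t' ys = Suc z"
    using Comp.IH(2) by blast
  define s where "s = t' + (\<Sum>i<length gs. t i)"
  have le: "t i \<le> s" if "i < length gs" for i
    unfolding s_def using that by (intro trans_le_add2 member_le_sum) auto
  have gs: "staged A (gs ! i) s xs = Suc (ys ! i)" if "i < length gs" for i
    using staged_mono t le that by metis
  then have "map (\<lambda>g. staged A g s xs - 1) gs = ys"
    using Comp.IH(1) by (auto simp: list_all2_conv_all_nth intro!: nth_equalityI)
  moreover have "\<not> (\<exists>g\<in>set gs. staged A g s xs = 0)"
    using gs by (auto simp: in_set_conv_nth)
  moreover have "staged A f s ys = Suc z"
    using staged_mono[OF t'] unfolding s_def by simp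
  ultimately have "staged A (Comp f gs) s xs = Suc z"
    by simp
  then show ?case ..
next
  case (PrimRec_0 f xs z g)
  then show ?case by simp
next
  case (PrimRec_Suc f g n xs y z)
  then obtain s t where s: "staged A (PrimRec f g) s (n # xs) = Suc y"
    and t: "staged A g t (n # y # xs) = Suc z"
    by blast
  have "staged A (PrimRec f g) (max s t) (n # xs) = Suc y"
    by (rule staged_mono[OF s]) simp
  moreover have "staged A g (max s t) (n # y # xs) = Suc z"
    by (rule staged_mono[OF t]) simp
  ultimately have "staged A (PrimRec f g) (max s t) (Suc n # xs) = Suc z"
    by (simp cong: if_cong)
  then show ?case ..
next
  case (Mu f n xs)
  obtain t where t: "staged A f t (n # xs) = Suc 0"
    using Mu.IH(1) by auto
  have "\<forall>m<n. \<exists>s. 1 < staged A f s (m # xs)"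
  proof (intro allI impI)
    fix m assume "m < n"
    with Mu.IH(2) obtain r s where "0 < r" "staged A f s (m # xs) = Suc r"
      by blast
    then have "1 < staged A f s (m # xs)" by simp
    then show "\<exists>s. 1 < staged A f s (m # xs)" ..
  qed
  then obtain u where u: "\<forall>m<n. 1 < staged A f (u m) (m # xs)"
    by metis
  \<comment> \<open>The summand \<open>Suc n\<close> keeps the root below the bound of the
    search.\<close>
  define s where "s = Suc n + t + (\<Sum>m<n. u m)"
  have "u m \<le> s" if "m < n" for m
    unfolding s_def using that by (intro trans_le_add2 member_le_sum) auto
  then have "1 < staged A f s (m # xs)" if "m < n" for m
    using u that staged_mono by (metis One_nat_def Suc_lessE)
  moreover have "staged A f s (n # xs) = 1" "n < s"
    using staged_mono[OF t] unfolding s_def by auto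
  ultimately have "staged A (Mu f) s xs = Suc n"
    unfolding staged_Mu_iff by blast
  then show ?case ..
qed auto

theorem eval_iff_staged: "eval A p xs y \<longleftrightarrow> (\<exists>s. staged A p s xs = Suc y)"
proof
  assume "eval A p xs y"
  then show "\<exists>s. staged A p s xs = Suc y" by (rule staged_if_eval)
next
  assume "\<exists>s. staged A p s xs = Suc y"
  then obtain s where "staged A p s xs = Suc y" ..
  then show "eval A p xs y" by (rule eval_if_staged)
qed

text \<open>Induction on the fixed term \<open>p\<close> replaces a universal function and any
  coding of programs. The arity varies because subterms take lists of other lengths.\<close>

lemma computable_staged:
  "computable A (Suc k) (\<lambda>xs. staged A p (hd xs) (tl xs))"
proof (induction p arbitrary: k)
  case Zero
  show ?case by (simp add: computable_const)
next
  case Succ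
  show ?case
  proof (cases "k = 1")
    case True
    have "computable A (Suc k) (\<lambda>xs. Suc (Suc (xs ! 1)))"
      using True by (intro computable_intros computable_oracle) simp
    then show ?thesis
      by (rule computable_cong[THEN iffD1, rotated]) (use True in \<open>auto simp: nth_tl\<close>)
  next
    case False
    then show ?thesis
      by (subst computable_cong[where G = "\<lambda>_. 0"]) (auto simp: computable_const)
  qed
next
  case Oracle
  show ?case
  proof (cases "k = 1")
    case True
    have "computable A (Suc k) (\<lambda>xs. Suc (A (xs ! 1)))"
      using True by (intro computable_intros computable_oracle) simp
    then show ?thesis
      by (rule computable_cong[THEN iffD1, rotated]) (use True in \<open>auto simp: nth_tl\<close>)
  next
    case False
    then show ?thesis
      by (subst computable_cong[where G = "\<lambda>_. 0"]) (auto simp: computable_const)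
  qed
next
  case (Proj i)
  show ?case
  proof (cases "i < k")
    case True
    have "computable A (Suc k) (\<lambda>xs. Suc (xs ! Suc i))"
      using True by (intro computable_intros computable_oracle) simp
    then show ?thesis
      by (rule computable_cong[THEN iffD1, rotated]) (use True in \<open>auto simp: nth_tl\<close>)
  next
    case False
    then show ?thesis
      by (subst computable_cong[where G = "\<lambda>_. 0"]) (auto simp: computable_const)
  qed
next
  case (Comp f gs)
  have "decidable A (Suc k) (\<lambda>xs. \<exists>g\<in>set hs. staged A g (hd xs) (tl xs) = 0)"
    if "set hs \<subseteq> set gs" for hs
    using that
  proof (induction hs)
    case (Cons h hs)
    then show ?case
      by (simp only: list.set bex_simps) (intro computable_intros; simp add: Comp.IH(2))
  qed (simp add: computable_const)
  then have zero: "decidable A (Suc k) (\<lambda>xs. \<exists>g\<in>set gs. staged A g (hd xs) (tl xs) = 0)"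
    by blast
  let ?Fs = "(\<lambda>xs. xs ! 0) # map (\<lambda>g xs. staged A g (hd xs) (tl xs) - 1) gs"
  have "computable A (Suc k) (\<lambda>xs. staged A f (hd (map (\<lambda>F. F xs) ?Fs)) (tl (map (\<lambda>F. F xs) ?Fs)))"
    by (rule computable_comp[where G = "\<lambda>xs. staged A f (hd xs) (tl xs)"])
      (use Comp.IH in \<open>auto intro!: computable_intros\<close>)
  then have "computable A (Suc k) (\<lambda>xs. if \<exists>g\<in>set gs. staged A g (hd xs) (tl xs) = 0 then 0
      else staged A f (xs ! 0) (map (\<lambda>g. staged A g (hd xs) (tl xs) - 1) gs))"
    by (intro computable_if zero computable_const) (simp add: comp_def)
  then show ?case
    by (rule computable_cong[THEN iffD1, rotated]) (auto simp: length_Suc_conv)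
next
  case (PrimRec f g)
  show ?case
  proof (cases k)
    case 0
    then show ?thesis
      by (subst computable_cong[where G = "\<lambda>_. 0"]) (auto simp: computable_const length_Suc_conv)
  next
    case (Suc j)
    have f: "computable A (Suc k) (\<lambda>xs. staged A f (xs ! 0) (drop 2 xs))"
    proof -
      let ?Fs = "(\<lambda>xs. xs ! 0) # map (\<lambda>i xs. xs ! Suc (Suc i)) [0..<j]"
      have "computable A (Suc k)
          (\<lambda>xs. staged A f (hd (map (\<lambda>F. F xs) ?Fs)) (tl (map (\<lambda>F. F xs) ?Fs)))"
        by (rule computable_comp[where G = "\<lambda>xs. staged A f (hd xs) (tl xs)"])
          (use PrimRec.IH Suc in \<open>auto intro!: computable_intros\<close>)
      moreover have "map (\<lambda>i. xs ! Suc (Suc i)) [0..<j] = drop 2 xs"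
        if "length xs = Suc k" for xs :: "nat list"
        using that Suc by (intro nth_equalityI) auto
      ultimately show ?thesis
        by (subst computable_cong[where G = "\<lambda>xs. staged A f (hd (map (\<lambda>F. F xs) ?Fs)) (tl (map (\<lambda>F. F xs) ?Fs))"])
          (auto simp: comp_def)
    qed
    have g: "computable A (Suc (Suc (Suc k))) (\<lambda>xs. staged A g (xs ! 2) (xs ! 0 # (xs ! 1 - 1) # drop 4 xs))"
    proof -
      let ?Fs = "(\<lambda>xs. xs ! 2) # (\<lambda>xs. xs ! 0) # (\<lambda>xs. xs ! 1 - 1) # map (\<lambda>i xs. xs ! (4 + i)) [0..<j]"
      have "computable A (Suc (Suc (Suc k)))
          (\<lambda>xs. staged A g (hd (map (\<lambda>F. F xs) ?Fs)) (tl (map (\<lambda>F. F xs) ?Fs)))"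
        by (rule computable_comp[where G = "\<lambda>xs. staged A g (hd xs) (tl xs)"])
          (use PrimRec.IH Suc in \<open>auto intro!: computable_intros\<close>)
      moreover have "map (\<lambda>i. xs ! (4 + i)) [0..<j] = drop 4 xs"
        if "length xs = Suc (Suc (Suc k))" for xs :: "nat list"
        using that Suc by (intro nth_equalityI) auto
      ultimately show ?thesis
        by (subst computable_cong[where G = "\<lambda>xs. staged A g (hd (map (\<lambda>F. F xs) ?Fs)) (tl (map (\<lambda>F. F xs) ?Fs))"])
          (auto simp: comp_def)
    qed
    have "computable A (Suc k) (\<lambda>xs. rec_nat (staged A f (xs ! 0) (drop 2 xs))
        (\<lambda>i r. if r = 0 then 0 else staged A g (xs ! 0) (i # (r - 1) # drop 2 xs)) (xs ! 1))"
    proof (intro computable_rec_nat f)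
      have "computable A (Suc (Suc (Suc k)))
          (\<lambda>xs. if xs ! 1 = 0 then 0 else staged A g (xs ! 2) (xs ! 0 # (xs ! 1 - 1) # drop 4 xs))"
        by (intro computable_if decidable_eq computable_const computable_nth g) simp
      then show "computable A (Suc (Suc (Suc k))) (\<lambda>xs. if xs ! 1 = 0 then 0
          else staged A g (drop 2 xs ! 0) (xs ! 0 # (xs ! 1 - 1) # drop 2 (drop 2 xs)))"
        by (rule computable_cong[THEN iffD1, rotated]) simp
    qed (use Suc in \<open>intro computable_nth; simp\<close>)
    then show ?thesis
      by (rule computable_cong[THEN iffD1, rotated])
        (use Suc in \<open>auto simp: length_Suc_conv cong: if_cong\<close>)
  qed
next
  case (Mu f)
  have f: "computable A (Suc (Suc k)) (\<lambda>xs. staged A f (xs ! 1) (xs ! 0 # drop 2 xs))"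
  proof -
    let ?Fs = "(\<lambda>xs. xs ! 1) # (\<lambda>xs. xs ! 0) # map (\<lambda>i xs. xs ! (2 + i)) [0..<k]"
    have "computable A (Suc (Suc k))
        (\<lambda>xs. staged A f (hd (map (\<lambda>F. F xs) ?Fs)) (tl (map (\<lambda>F. F xs) ?Fs)))"
      by (rule computable_comp[where G = "\<lambda>xs. staged A f (hd xs) (tl xs)"])
        (use Mu.IH in \<open>auto intro!: computable_intros\<close>)
    moreover have "map (\<lambda>i. xs ! (2 + i)) [0..<k] = drop 2 xs"
      if "length xs = Suc (Suc k)" for xs :: "nat list"
      using that by (intro nth_equalityI) auto
    ultimately show ?thesis
      by (subst computable_cong[where G = "\<lambda>xs. staged A f (hd (map (\<lambda>F. F xs) ?Fs)) (tl (map (\<lambda>F. F xs) ?Fs))"])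
        (auto simp: comp_def)
  qed
  let ?P = "\<lambda>n xs. xs ! 0 \<le> n \<or> staged A f (xs ! 0) (n # drop 1 xs) \<le> 1"
  have least: "computable A (Suc k) (\<lambda>xs. LEAST n. ?P n xs)"
  proof (rule computable_Least)
    have "decidable A (Suc (Suc k)) (\<lambda>xs. xs ! 1 \<le> xs ! 0 \<or> staged A f (xs ! 1) (xs ! 0 # drop 2 xs) \<le> 1)"
      by (intro decidable_disj decidable_le computable_nth f computable_const) auto
    then show "decidable A (Suc (Suc k)) (\<lambda>xs. ?P (xs ! 0) (drop 1 xs))"
      by (rule computable_cong[THEN iffD1, rotated]) (auto simp: length_Suc_conv)
  qed blast
  have sub: "computable A (Suc k) (\<lambda>xs. staged A f (xs ! 0) ((LEAST n. ?P n xs) # drop 1 xs))"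
  proof -
    let ?Fs = "(\<lambda>xs. xs ! 0) # (\<lambda>xs. LEAST n. ?P n xs) # map (\<lambda>i xs. xs ! (1 + i)) [0..<k]"
    have "computable A (Suc k)
        (\<lambda>xs. staged A f (hd (map (\<lambda>F. F xs) ?Fs)) (tl (map (\<lambda>F. F xs) ?Fs)))"
      by (rule computable_comp[where G = "\<lambda>xs. staged A f (hd xs) (tl xs)"])
        (use Mu.IH least in \<open>auto intro!: computable_nth\<close>)
    moreover have "map (\<lambda>i. xs ! (1 + i)) [0..<k] = drop 1 xs"
      if "length xs = Suc k" for xs :: "nat list"
      using that by (intro nth_equalityI) auto
    ultimately show ?thesis
      by (subst computable_cong[where G = "\<lambda>xs. staged A f (hd (map (\<lambda>F. F xs) ?Fs)) (tl (map (\<lambda>F. F xs) ?Fs))"])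
        (auto simp: comp_def)
  qed
  have "computable A (Suc k) (\<lambda>xs. if (LEAST n. ?P n xs) < xs ! 0
      \<and> staged A f (xs ! 0) ((LEAST n. ?P n xs) # drop 1 xs) = 1 then Suc (LEAST n. ?P n xs) else 0)"
    by (intro computable_if decidable_conj decidable_less decidable_eq computable_nth
        computable_const computable_Suc least sub) simp
  then show ?case
    by (rule computable_cong[THEN iffD1, rotated]) (auto simp: length_Suc_conv Let_def)
qed

lemma computable_staged_unary:
  "computable A 2 (\<lambda>xs. staged A p (xs ! 0) [xs ! 1])"
  using computable_staged[of A 1 p]
  by (subst computable_cong[where G = "\<lambda>xs. staged A p (hd xs) (tl xs)"])
    (auto simp: numeral_2_eq_2 length_Suc_conv)

section \<open>The measure of a node\<close>

lemma string_code_append: "string_code (\<sigma> @ [b]) = string_code \<sigma> + 2 ^ length \<sigma> * (if b then 2 else 1)"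
  by (induction \<sigma>) auto

text \<open>\<open>Suc (string_code \<sigma>)\<close> is the binary number whose digits, least
  significant first, are those of \<sigma> followed by a leading 1.\<close>

lemma string_code_bounds:
  "2 ^ length \<sigma> \<le> Suc (string_code \<sigma>)" "Suc (string_code \<sigma>) < 2 * 2 ^ length \<sigma>"
  by (induction \<sigma>) auto

lemma surj_string_code: "\<exists>\<sigma>. string_code \<sigma> = n"
proof (induction n rule: less_induct)
  case (less n)
  show ?case
  proof (cases n)
    case 0
    then show ?thesis by (intro exI[of _ "[]"]) simp
  next
    case (Suc m)
    then have "m div 2 < n"
      by (simp add: div_le_dividend le_imp_less_Suc)
    then obtain \<sigma> where "string_code \<sigma> = m div 2"
      using less.IH by blast
    then have "string_code (odd m # \<sigma>) = n"
      using Suc by (auto elim!: oddE evenE)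
    then show ?thesis ..
  qed
qed

lemma string_code_inject: "string_code \<sigma> = string_code \<tau> \<Longrightarrow> \<sigma> = \<tau>"
proof (induction \<sigma> arbitrary: \<tau>)
  case Nil
  then show ?case by (cases \<tau>) (auto split: if_splits)
next
  case (Cons b \<sigma>)
  then obtain c \<rho> where \<tau>: "\<tau> = c # \<rho>"
    by (cases \<tau>) (auto split: if_splits)
  have "b = c \<and> string_code \<sigma> = string_code \<rho>"
    using Cons.prems unfolding \<tau> by (auto split: if_splits; presburger)
  with Cons.IH \<tau> show ?case by simp
qed

text \<open>Nodes are numbers read least significant bit first: the prefix of length
  \<open>m\<close> is the residue modulo \<open>2 ^ m\<close>, and appending bits keeps it.\<close>

lemma string_code_prefix:
  "Suc (string_code (map (\<lambda>i. odd (v div 2 ^ i)) [0..<m])) = 2 ^ m + v mod 2 ^ m"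
proof (induction m)
  case (Suc m)
  have "v mod 2 ^ Suc m = v mod 2 ^ m + 2 ^ m * (v div 2 ^ m mod 2)"
    using mod_mult2_eq[of v "2 ^ m" 2] by (simp add: mult.commute)
  also have "v div 2 ^ m mod 2 = of_bool (odd (v div 2 ^ m))"
    by (simp add: mod2_eq_if)
  finally show ?case
    using Suc by (cases "odd (v div 2 ^ m)") (simp_all add: string_code_append)
qed simp

definition code_length :: "nat \<Rightarrow> nat" where
  "code_length x = (LEAST l. Suc x < 2 * 2 ^ l)"

lemma code_length_eqI:
  assumes "2 ^ l \<le> Suc x" "Suc x < 2 * 2 ^ l"
  shows "code_length x = l"
  unfolding code_length_def
proof (rule Least_equality)
  fix k assume "Suc x < 2 * 2 ^ k"
  with assms(1) have "(2::nat) ^ l < 2 ^ Suc k" by simp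
  then show "l \<le> k" by (simp only: power_strict_increasing_iff)
qed fact

lemma code_length_string_code [simp]: "code_length (string_code \<sigma>) = length \<sigma>"
  using string_code_bounds by (rule code_length_eqI)

text \<open>Only \<open>x < s\<close> enter \<open>mass\<close>, so this makes the exponent
  \<open>s - code_length x\<close> there a true difference.\<close>

lemma code_length_le: "code_length x \<le> x"
proof -
  obtain \<sigma> where \<sigma>: "string_code \<sigma> = x"
    using surj_string_code by blast
  show ?thesis
    using less_exp[of "length \<sigma>"] string_code_bounds(1)[of \<sigma>]
    unfolding \<sigma>[symmetric] code_length_string_code by linarith
qed

text \<open>Of the string coded by \<open>y\<close> and the node, one is a prefix of the other: the
  low \<open>code_length y\<close> bits of \<open>Suc y\<close> are the digits of the
  string.\<close>

definition compatible :: "nat \<Rightarrow> nat \<Rightarrow> nat \<Rightarrow> bool" where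
  "compatible y v l \<longleftrightarrow> Suc y mod 2 ^ min l (code_length y) = v mod 2 ^ min l (code_length y)"

text \<open>This is \<open>2 ^ l\<close> times the share of the string's cylinder that lies in the
  node: for a compatible string the share is \<open>2 ^ code_length y / 2 ^ l\<close> if it is
  shorter than the node, and 1 if it is longer.\<close>

definition weight :: "nat \<Rightarrow> nat \<Rightarrow> nat \<Rightarrow> nat" where
  "weight y v l = (if compatible y v l then 2 ^ min l (code_length y) else 0)"

text \<open>The measure of the node with value \<open>v\<close> and length \<open>l\<close> at stage \<open>s\<close>, scaled by \<open>2 ^ (s + l)\<close>
  so that it becomes an integer. Strings are given by their codes, and \<open>R s x = Suc y\<close> means
  that the machine has produced \<open>y\<close> from \<open>x\<close> by stage \<open>s\<close>.\<close>

definition mass :: "(nat \<Rightarrow> nat \<Rightarrow> nat) \<Rightarrow> nat \<Rightarrow> nat \<Rightarrow> nat \<Rightarrow> nat" where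
  "mass R s v l =
    (\<Sum>x<s. if R s x = 0 then 0 else 2 ^ (s - code_length x) * weight (R s x - 1) v l)"

text \<open>Additivity of the measure; the factor 2 is the change of scale from \<open>2 ^ l\<close>
  to \<open>2 ^ Suc l\<close>. A string of length at most \<open>l\<close> is compatible with both
  children or with neither, a longer one with at most one.\<close>

lemma weight_split:
  assumes "v < 2 ^ l"
  shows "weight y v (Suc l) + weight y (v + 2 ^ l) (Suc l) \<le> 2 * weight y v l"
proof (cases "code_length y \<le> l")
  case True
  then have "2 ^ code_length y dvd (2::nat) ^ l"
    by (rule le_imp_power_dvd)
  then have "(v + 2 ^ l) mod 2 ^ code_length y = v mod 2 ^ code_length y"
    by (metis add.right_neutral mod_0_imp_dvd mod_add_right_eq dvd_imp_mod_0)
  with True show ?thesis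
    by (simp add: weight_def compatible_def min_def)
next
  case False
  let ?z = "Suc y mod 2 ^ Suc l"
  have "Suc y mod 2 ^ l = ?z mod 2 ^ l"
    by (simp add: mod_mod_cancel)
  with False assms show ?thesis
    by (auto simp: weight_def compatible_def min_def)
qed

lemma mass_split:
  assumes "v < 2 ^ l"
  shows "mass R s v (Suc l) + mass R s (v + 2 ^ l) (Suc l) \<le> 2 * mass R s v l"
  unfolding mass_def sum_distrib_left sum.distrib[symmetric]
proof (rule sum_mono)
  fix x
  show "(if R s x = 0 then 0 else 2 ^ (s - code_length x) * weight (R s x - 1) v (Suc l))
      + (if R s x = 0 then 0 else 2 ^ (s - code_length x) * weight (R s x - 1) (v + 2 ^ l) (Suc l))
    \<le> 2 * (if R s x = 0 then 0 else 2 ^ (s - code_length x) * weight (R s x - 1) v l)"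
    using mult_le_mono2[OF weight_split[OF assms, of "R s x - 1"], of "2 ^ (s - code_length x)"]
    by (simp add: algebra_simps)
qed

lemma block_less:
  assumes "v < 2 ^ l" "t < 2 ^ k"
  shows "v + 2 ^ l * t < (2::nat) ^ (l + k)"
proof -
  have "v + 2 ^ l * t < 2 ^ l * Suc t" using assms(1) by simp
  also have "\<dots> \<le> 2 ^ l * 2 ^ k" using assms(2) by (intro mult_le_mono2) simp
  finally show ?thesis by (simp add: power_add)
qed

lemma mass_block:
  assumes "v < 2 ^ l"
  shows "(\<Sum>t<2 ^ k. mass R s (v + 2 ^ l * t) (l + k)) \<le> 2 ^ k * mass R s v l"
proof (induction k)
  case (Suc k)
  let ?f = "\<lambda>t. mass R s (v + 2 ^ l * t) (l + Suc k)"
  \<comment> \<open>The top bit of the block number is the last bit of the block; separating it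
    leaves blocks of length \<open>k\<close>.\<close>
  have "(\<Sum>t<2 ^ Suc k. ?f t) = (\<Sum>t<2 ^ k. ?f t) + (\<Sum>t\<in>{2 ^ k..<2 ^ Suc k}. ?f t)"
    by (subst sum.union_disjoint[symmetric]) (auto intro!: sum.cong)
  also have "(\<Sum>t\<in>{2 ^ k..<2 ^ Suc k}. ?f t) = (\<Sum>t<2 ^ k. ?f (t + 2 ^ k))"
    using sum.shift_bounds_nat_ivl[of ?f 0 "2 ^ k" "2 ^ k"] by (simp add: lessThan_atLeast0 mult_2)
  also have "(\<Sum>t<2 ^ k. ?f t) + (\<Sum>t<2 ^ k. ?f (t + 2 ^ k)) = (\<Sum>t<2 ^ k. ?f t + ?f (t + 2 ^ k))"
    by (simp add: sum.distrib)
  also have "\<dots> \<le> (\<Sum>t<2 ^ k. 2 * mass R s (v + 2 ^ l * t) (l + k))"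
  proof (rule sum_mono)
    fix t :: nat assume "t \<in> {..<2 ^ k}"
    then have "v + 2 ^ l * t < 2 ^ (l + k)"
      using block_less[OF assms] by simp
    from mass_split[OF this, of R s]
    show "?f t + ?f (t + 2 ^ k) \<le> 2 * mass R s (v + 2 ^ l * t) (l + k)"
      by (simp add: power_add algebra_simps)
  qed
  also have "\<dots> = 2 * (\<Sum>t<2 ^ k. mass R s (v + 2 ^ l * t) (l + k))"
    by (simp add: sum_distrib_left)
  also have "\<dots> \<le> 2 * (2 ^ k * mass R s v l)"
    using Suc.IH by simp
  finally show ?case by simp
qed simp

text \<open>With the scaling of \<open>mass\<close>, the node has measure at least
  \<open>2 n^n / 2^l\<close> for \<open>l = triangle n\<close>, the total length of the first
  \<open>n\<close> blocks.\<close>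

definition heavy :: "(nat \<Rightarrow> nat \<Rightarrow> nat) \<Rightarrow> nat \<Rightarrow> nat \<Rightarrow> nat \<Rightarrow> bool" where
  "heavy R s n v \<longleftrightarrow> 2 ^ Suc s * n ^ n \<le> mass R s v (triangle n)"

definition heavy_child :: "(nat \<Rightarrow> nat \<Rightarrow> nat) \<Rightarrow> nat \<Rightarrow> nat \<Rightarrow> nat \<Rightarrow> nat \<Rightarrow> bool" where
  "heavy_child R s n v t \<longleftrightarrow> heavy R s (Suc n) (v + 2 ^ triangle n * t)"

text \<open>An averaging argument: up to the scale \<open>2 ^ Suc n\<close>, the children together
  carry at most the mass of the node, while each heavy one needs \<open>Suc n ^ Suc n\<close>, at
  least \<open>Suc n\<close> times \<open>n ^ n\<close>.\<close>

lemma card_heavy_child: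
  assumes v: "v < 2 ^ triangle n" and "\<not> heavy R s n v"
  shows "card {t. t < 2 ^ Suc n \<and> heavy_child R s n v t} * Suc n < 2 ^ Suc n"
proof -
  let ?E = "{t. t < 2 ^ Suc n \<and> heavy_child R s n v t}"
  have "card ?E * (2 ^ Suc s * Suc n ^ Suc n) = (\<Sum>t\<in>?E. 2 ^ Suc s * Suc n ^ Suc n)"
    by simp
  also have "\<dots> \<le> (\<Sum>t\<in>?E. mass R s (v + 2 ^ triangle n * t) (triangle (Suc n)))"
    unfolding heavy_child_def heavy_def by (intro sum_mono) simp
  also have "\<dots> \<le> (\<Sum>t<2 ^ Suc n. mass R s (v + 2 ^ triangle n * t) (triangle (Suc n)))"
    by (intro sum_mono2) auto
  also have "\<dots> \<le> 2 ^ Suc n * mass R s v (triangle n)"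
    using mass_block[OF v, of R s "Suc n"] by simp
  also have "\<dots> < 2 ^ Suc n * (2 ^ Suc s * n ^ n)"
    using assms(2) unfolding heavy_def by (intro mult_strict_left_mono) auto
  also have "\<dots> \<le> 2 ^ Suc n * (2 ^ Suc s * Suc n ^ n)"
    by (intro mult_le_mono2 power_mono) auto
  finally have "(card ?E * Suc n) * (2 ^ Suc s * Suc n ^ n) < 2 ^ Suc n * (2 ^ Suc s * Suc n ^ n)"
    by (simp add: algebra_simps)
  then show ?thesis
    by (rule mult_less_cancel2[THEN iffD1, THEN conjunct2])
qed

section \<open>Light nodes along an enumeration of computations\<close>

locale enumeration =
  fixes R :: "nat \<Rightarrow> nat \<Rightarrow> nat"
  assumes mono: "R s x = Suc y \<Longrightarrow> s \<le> s' \<Longrightarrow> R s' x = Suc y"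
begin

lemma mass_mono: "2 ^ (s' - s) * mass R s v l \<le> mass R s' v l" if "s \<le> s'"
proof -
  let ?f = "\<lambda>s x. if R s x = 0 then 0 else 2 ^ (s - code_length x) * weight (R s x - 1) v l"
  have "2 ^ (s' - s) * ?f s x \<le> ?f s' x" if "x < s" for x
  proof (cases "R s x")
    case (Suc y)
    have "2 ^ (s' - s) * 2 ^ (s - code_length x) = (2::nat) ^ (s' - code_length x)"
      using \<open>s \<le> s'\<close> \<open>x < s\<close> code_length_le[of x] by (simp flip: power_add)
    then show ?thesis
      using Suc mono[OF Suc \<open>s \<le> s'\<close>] by (simp flip: mult.assoc)
  qed simp
  then have "2 ^ (s' - s) * mass R s v l \<le> (\<Sum>x<s. ?f s' x)"
    unfolding mass_def sum_distrib_left by (intro sum_mono) simp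
  also have "\<dots> \<le> mass R s' v l"
    unfolding mass_def using that by (intro sum_mono2) auto
  finally show ?thesis .
qed

lemma heavy_mono: "heavy R s n v \<Longrightarrow> s \<le> s' \<Longrightarrow> heavy R s' n v"
proof -
  assume *: "heavy R s n v" "s \<le> s'"
  have "2 ^ Suc s' * n ^ n = 2 ^ (s' - s) * (2 ^ Suc s * n ^ n)"
    using *(2) by (simp flip: power_add mult.assoc)
  also have "\<dots> \<le> 2 ^ (s' - s) * mass R s v (triangle n)"
    using *(1) unfolding heavy_def by (rule mult_le_mono2)
  also have "\<dots> \<le> mass R s' v (triangle n)"
    using *(2) by (rule mass_mono)
  finally show "heavy R s' n v" unfolding heavy_def .
qed

lemma heavy_child_mono: "heavy_child R s n v t \<Longrightarrow> s \<le> s' \<Longrightarrow> heavy_child R s' n v t"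
  unfolding heavy_child_def by (rule heavy_mono)

text \<open>Lightness quantifies over all stages; a finite stage can refute it but not confirm it,
  which is where the oracle comes in.\<close>

definition light :: "nat \<Rightarrow> nat \<Rightarrow> bool" where
  "light n v \<longleftrightarrow> v < 2 ^ triangle n \<and> (\<forall>s. \<not> heavy R s n v)"

lemma light_child_if_not_heavy:
  assumes "light n v" "t < 2 ^ Suc n" "\<And>s. \<not> heavy_child R s n v t"
  shows "light (Suc n) (v + 2 ^ triangle n * t)"
  using assms block_less[of v "triangle n" t "Suc n"] unfolding light_def heavy_child_def by simp

text \<open>If all children became heavy, a stage beyond all those involved would show all of them
  heavy at once, against \<open>card_heavy_child\<close>.\<close>

lemma ex_light_child:
  assumes "light n v"
  shows "\<exists>t<2 ^ Suc n. light (Suc n) (v + 2 ^ triangle n * t)"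
proof (rule ccontr)
  assume "\<not> ?thesis"
  then have "\<forall>t<2 ^ Suc n. \<exists>s. heavy_child R s n v t"
    using light_child_if_not_heavy[OF assms] by blast
  then obtain s where s: "\<And>t. t < 2 ^ Suc n \<Longrightarrow> heavy_child R (s t) n v t"
    by metis
  define m where "m = (\<Sum>t<2 ^ Suc n. s t)"
  have "heavy_child R m n v t" if "t < 2 ^ Suc n" for t
  proof (rule heavy_child_mono[OF s[OF that]])
    show "s t \<le> m"
      unfolding m_def by (rule member_le_sum) (use that in auto)
  qed
  then have "{t. t < 2 ^ Suc n \<and> heavy_child R m n v t} = {..<2 ^ Suc n}"
    by auto
  moreover have "v < 2 ^ triangle n" "\<not> heavy R m n v"
    using assms unfolding light_def by auto
  ultimately show False
    using card_heavy_child[of v n R m] by simp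
qed

text \<open>The computation from \<open>x\<close>, of length k say, puts 2^-k on the cylinder of the
  prefix, of which the node of length l receives 2^-k 2^(m-l); lightness keeps this below
  \<open>2 n^n / 2^l\<close>.\<close>

lemma complexity_light:
  assumes "light n v" "m \<le> triangle n" "R s x = Suc y" "Suc y = 2 ^ m + v mod 2 ^ m"
  shows "2 ^ m < 2 ^ Suc (code_length x) * n ^ n"
proof -
  \<comment> \<open>At this stage the output is present and \<open>x\<close> is among the inputs
    summed in \<open>mass\<close>.\<close>
  define s' where "s' = max s (Suc x)"
  have R: "R s' x = Suc y"
    using mono[OF assms(3)] unfolding s'_def by simp
  have "v mod 2 ^ m < 2 ^ m" by simp
  then have len: "code_length y = m"
    using assms(4) by (intro code_length_eqI) (simp_all del: mod_less_divisor)
  have "weight y v (triangle n) = 2 ^ m"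
    using assms(2,4) by (simp add: weight_def compatible_def len)
  then have "2 ^ (s' - code_length x) * 2 ^ m \<le> mass R s' v (triangle n)"
    unfolding mass_def using R
    member_le_sum[of x "{..<s'}" "\<lambda>x. if R s' x = 0 then 0 else 2 ^ (s' - code_length x) * weight (R s' x - 1) v (triangle n)"]
    by (simp add: s'_def)
  also have "\<dots> < 2 ^ Suc s' * n ^ n"
    using assms(1) unfolding light_def heavy_def by (simp add: not_le)
  also have "\<dots> = 2 ^ (s' - code_length x) * (2 ^ Suc (code_length x) * n ^ n)"
    using code_length_le[of x] by (simp add: s'_def flip: power_add mult.assoc)
  finally show ?thesis by simp
qed

end

section \<open>Kraft's inequality and light nodes of every level\<close>

text \<open>Induction on the length bound, splitting by the first bit; the empty string is a prefix
  of every string and so can only occur alone.\<close>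

lemma kraft_inequality:
  fixes F :: "bool list set"
  assumes "finite F" "\<And>\<sigma>. \<sigma> \<in> F \<Longrightarrow> length \<sigma> \<le> N"
    "\<And>\<sigma> \<tau>. \<sigma> \<in> F \<Longrightarrow> \<tau> \<in> F \<Longrightarrow> prefix \<sigma> \<tau> \<Longrightarrow> \<sigma> = \<tau>"
  shows "(\<Sum>\<sigma>\<in>F. 2 ^ (N - length \<sigma>)) \<le> (2::nat) ^ N"
  using assms
proof (induction N arbitrary: F)
  case 0
  then have "F \<subseteq> {[]}" by auto
  then have "F = {} \<or> F = {[]}" by blast
  then show ?case by auto
next
  case (Suc N)
  show ?case
  proof (cases "[] \<in> F")
    case True
    then have "F = {[]}" using Suc.prems(3)[of "[]"] by auto
    then show ?thesis by simp
  next
    case False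
    define G where "G b = {\<sigma>. b # \<sigma> \<in> F}" for b
    have F: "F = (#) True ` G True \<union> (#) False ` G False"
    proof (intro set_eqI iffI)
      fix \<sigma> assume "\<sigma> \<in> F"
      with False obtain b \<tau> where "\<sigma> = b # \<tau>" "\<tau> \<in> G b"
        unfolding G_def by (cases \<sigma>) auto
      then show "\<sigma> \<in> (#) True ` G True \<union> (#) False ` G False"
        by (cases b) auto
    qed (auto simp: G_def)
    have fin: "finite (G b)" for b
    proof -
      have "finite ((#) b -` F)"
        by (rule finite_vimageI[OF Suc.prems(1)]) simp
      then show ?thesis by (simp add: G_def vimage_def)
    qed
    have G: "(\<Sum>\<sigma>\<in>G b. 2 ^ (N - length \<sigma>)) \<le> (2::nat) ^ N" for b
      using Suc.prems(2,3) by (intro Suc.IH fin) (force simp: G_def)+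
    have "(\<Sum>\<sigma>\<in>F. 2 ^ (Suc N - length \<sigma>)) =
        (\<Sum>\<sigma>\<in>(#) True ` G True. 2 ^ (Suc N - length \<sigma>)) + (\<Sum>\<sigma>\<in>(#) False ` G False. (2::nat) ^ (Suc N - length \<sigma>))"
      by (subst F, rule sum.union_disjoint) (use fin in auto)
    also have "\<dots> = (\<Sum>\<sigma>\<in>G True. 2 ^ (N - length \<sigma>)) + (\<Sum>\<sigma>\<in>G False. 2 ^ (N - length \<sigma>))"
      by (subst (1 2) sum.reindex) (auto simp: inj_on_def)
    also have "\<dots> \<le> 2 ^ Suc N"
      using G[of True] G[of False] by simp
    finally show ?thesis .
  qed
qed

locale prefix_free_enumeration = enumeration +
  assumes prefix_free:
    "R s (string_code \<sigma>) \<noteq> 0 \<Longrightarrow> R s (string_code \<tau>) \<noteq> 0 \<Longrightarrow> prefix \<sigma> \<tau> \<Longrightarrow> \<sigma> = \<tau>"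
begin

text \<open>At the root \<open>n ^ n\<close> is \<open>0 ^ 0 = 1\<close>, so the threshold is twice
  the largest measure that Kraft's inequality allows.\<close>

lemma light_root: "light 0 0"
proof -
  have "\<not> heavy R s 0 0" for s
  proof -
    let ?X = "{x. x < s \<and> R s x \<noteq> 0}"
    define F where "F = {\<sigma>. string_code \<sigma> \<in> ?X}"
    have X: "?X = string_code ` F"
      unfolding F_def using surj_string_code by (auto simp: image_iff) metis
    have inj: "inj_on string_code F"
      by (auto intro: inj_onI string_code_inject)
    have fin: "finite F"
      using finite_image_iff[OF inj] X by (metis (no_types, lifting) finite_nat_set_iff_bounded mem_Collect_eq)
    have "mass R s 0 0 = (\<Sum>x\<in>?X. 2 ^ (s - code_length x))"
      unfolding mass_def by (rule sum.mono_neutral_cong_right) (auto simp: weight_def compatible_def)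
    also have "\<dots> = (\<Sum>\<sigma>\<in>F. 2 ^ (s - length \<sigma>))"
      unfolding X sum.reindex[OF inj] by simp
    also have "\<dots> \<le> 2 ^ s"
    proof (rule kraft_inequality[OF fin])
      show "length \<sigma> \<le> s" if "\<sigma> \<in> F" for \<sigma>
        using that code_length_le[of "string_code \<sigma>"] unfolding F_def by simp
    qed (auto simp: F_def intro: prefix_free[of s])
    finally have "mass R s 0 0 \<le> 2 ^ s" .
    then have "mass R s 0 0 < 2 * 2 ^ s"
      using zero_less_power[of "2::nat" s] by linarith
    then show ?thesis unfolding heavy_def by simp
  qed
  then show ?thesis unfolding light_def by simp
qed

text \<open>The construction starts at a level where the bound on the oracle is already in force.
  Its initial node is a single number, so existence without computability suffices.\<close>

lemma ex_light: "\<exists>v. light n v"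
proof (induction n)
  case 0
  show ?case using light_root ..
next
  case (Suc n)
  then show ?case using ex_light_child by blast
qed

end

section \<open>Enumeration of the heavy children\<close>

text \<open>The number \<open>u\<close> codes a stage and a child, the stage in the higher digits,
  so the order of \<open>u\<close> is that of enumeration. At stage 0 the truncated predecessor
  makes the two conjuncts contradictory.\<close>

definition entering :: "(nat \<Rightarrow> nat \<Rightarrow> nat) \<Rightarrow> nat \<Rightarrow> nat \<Rightarrow> nat \<Rightarrow> bool" where
  "entering R n v u \<longleftrightarrow> heavy_child R (u div 2 ^ Suc n) n v (u mod 2 ^ Suc n)
    \<and> \<not> heavy_child R (u div 2 ^ Suc n - 1) n v (u mod 2 ^ Suc n)"

text \<open>For an entry \<open>u\<close> this is the index i of its child in the list e_0, e_1,
  ...; a bounded sum rather than a cardinality makes it visibly computable.\<close>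

definition rank :: "(nat \<Rightarrow> nat \<Rightarrow> nat) \<Rightarrow> nat \<Rightarrow> nat \<Rightarrow> nat \<Rightarrow> nat" where
  "rank R n v u = (\<Sum>u'<u. of_bool (entering R n v u'))"

lemma rank_eq_card: "rank R n v u = card {u'. u' < u \<and> entering R n v u'}"
  unfolding rank_def by (simp add: sum.If_cases of_bool_def Collect_conj_eq lessThan_def)

lemma entering_unique:
  assumes "entering R n v u" "entering R n v u'" "rank R n v u = rank R n v u'"
  shows "u = u'"
proof -
  have less: "rank R n v u < rank R n v u'" if "u < u'" "entering R n v u" for u u'
    unfolding rank_eq_card using that by (intro psubset_card_mono) auto
  show ?thesis
    using less[of u u'] less[of u' u] assms by (metis less_irrefl linorder_neqE_nat)
qed

context enumeration
begin

lemma entering_unique_mod: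
  assumes "entering R n v u" "entering R n v u'" "u mod 2 ^ Suc n = u' mod 2 ^ Suc n"
  shows "u = u'"
proof -
  have le: "u' div 2 ^ Suc n \<le> u div 2 ^ Suc n"
    if "entering R n v u" "entering R n v u'" "u mod 2 ^ Suc n = u' mod 2 ^ Suc n" for u u'
  proof (rule ccontr)
    assume "\<not> ?thesis"
    then have "u div 2 ^ Suc n \<le> u' div 2 ^ Suc n - 1" by simp
    with that show False
      using heavy_child_mono unfolding entering_def by metis
  qed
  have "u div 2 ^ Suc n = u' div 2 ^ Suc n"
    using le assms by (metis antisym)
  with assms(3) show ?thesis
    by (metis div_mult_mod_eq)
qed

text \<open>The entries up to \<open>u\<close> belong to distinct children that are heavy at the
  stage of \<open>u\<close>; \<open>card_heavy_child\<close> bounds their number, and since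
  \<open>u\<close> is one of them the rank is strictly below the bound.\<close>

lemma ex_entering:
  assumes "light n v" "t < 2 ^ Suc n" "heavy_child R s n v t"
  shows "\<exists>u. entering R n v u \<and> u mod 2 ^ Suc n = t \<and> rank R n v u < 2 ^ Suc n div Suc n"
proof -
  define r where "r = (LEAST r. heavy_child R r n v t)"
  have r: "heavy_child R r n v t"
    unfolding r_def by (rule LeastI[of _ s]) fact
  \<comment> \<open>At stage 0 the mass is an empty sum.\<close>
  have "r \<noteq> 0"
  proof
    assume "r = 0"
    with r show False unfolding heavy_child_def heavy_def mass_def by simp
  qed
  then have r': "\<not> heavy_child R (r - 1) n v t"
    unfolding r_def by (intro not_less_Least) simp
  define u where "u = r * 2 ^ Suc n + t"
  have div: "u div 2 ^ Suc n = r" and mod: "u mod 2 ^ Suc n = t"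
    using assms(2) unfolding u_def by simp_all
  have u: "entering R n v u"
    unfolding entering_def div mod using r r' by simp
  let ?U = "{u'. u' < Suc u \<and> entering R n v u'}"
  let ?E = "{t. t < 2 ^ Suc n \<and> heavy_child R r n v t}"
  have "(\<lambda>u. u mod 2 ^ Suc n) ` ?U \<subseteq> ?E"
  proof clarify
    fix u' assume u': "u' < Suc u" "entering R n v u'"
    have "u' div 2 ^ Suc n \<le> r"
      unfolding div[symmetric] using u'(1) by (intro div_le_mono) simp
    then show "u' mod 2 ^ Suc n < 2 ^ Suc n \<and> heavy_child R r n v (u' mod 2 ^ Suc n)"
      using u'(2) heavy_child_mono unfolding entering_def by fastforce
  qed
  moreover have "inj_on (\<lambda>u. u mod 2 ^ Suc n) ?U"
    using entering_unique_mod by (auto simp: inj_on_def)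
  ultimately have "card ?U \<le> card ?E"
    by (intro card_inj_on_le[of "\<lambda>u. u mod 2 ^ Suc n"]) auto
  moreover have "card ?U = Suc (rank R n v u)"
  proof -
    have "?U = insert u {u'. u' < u \<and> entering R n v u'}"
      using u by auto
    then show ?thesis by (simp add: rank_eq_card)
  qed
  moreover have "card ?E * Suc n < 2 ^ Suc n"
    using assms(1) unfolding light_def by (intro card_heavy_child) auto
  then have "card ?E \<le> 2 ^ Suc n div Suc n"
    by (metis less_eq_div_iff_mult_less_eq less_imp_le zero_less_Suc)
  ultimately show ?thesis
    using u mod by (intro exI[of _ u]) simp
qed

end

section \<open>Blocks excluded by an avoiding oracle\<close>

definition digit :: "nat \<Rightarrow> nat \<Rightarrow> nat \<Rightarrow> nat" where
  "digit n T j = T div 2 ^ (Suc n * j) mod 2 ^ Suc n"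

lemma ex_digits:
  assumes "\<forall>j<k. d j < 2 ^ Suc n"
  shows "\<exists>T<2 ^ (Suc n * k). \<forall>j<k. digit n T j = d j"
  using assms
proof (induction k)
  case (Suc k)
  then obtain T where T: "T < 2 ^ (Suc n * k)" "\<forall>j<k. digit n T j = d j"
    by auto
  let ?T = "T + 2 ^ (Suc n * k) * d k"
  have "?T < 2 ^ (Suc n * k + Suc n)"
    using T(1) Suc.prems by (intro block_less) simp_all
  moreover have "digit n ?T j = d j" if "j < Suc k" for j
  proof (cases "j = k")
    case True
    then show ?thesis using T(1) Suc.prems by (simp add: digit_def)
  next
    case False
    with that have "j < k" by simp
    then obtain i where k: "k = Suc (j + i)"
      using less_imp_Suc_add by blast
    have "2 ^ (Suc n * k) * d k = 2 ^ (Suc n * j) * (2 ^ Suc n * (2 ^ (Suc n * i) * d k))"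
      unfolding k by (simp add: power_add algebra_simps)
    then have "?T div 2 ^ (Suc n * j) = T div 2 ^ (Suc n * j) + 2 ^ Suc n * (2 ^ (Suc n * i) * d k)"
      by (simp only:) simp
    then have "digit n ?T j = digit n T j"
      unfolding digit_def by (simp only: mod_mult_self2)
    with T(2) \<open>j < k\<close> show ?thesis by simp
  qed
  ultimately show ?case
    by (intro exI[of _ ?T]) (auto simp: algebra_simps)
qed simp

text \<open>The diagonal function returns the first position of e_i in \<open>T\<close>. An answer
  that avoids it therefore rules out the block whose first occurrence is at
  \<open>h T\<close>.\<close>

definition excluded :: "(nat \<Rightarrow> nat) \<Rightarrow> nat \<Rightarrow> nat \<Rightarrow> bool" where
  "excluded h n t \<longleftrightarrow>
    (\<exists>T<2 ^ (Suc n * Suc n). digit n T (h T) = t \<and> (\<forall>j<h T. digit n T j \<noteq> t))"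

text \<open>A tuple of \<open>n + 1\<close> distinct blocks that are not excluded would have one of
  them at position \<open>h T\<close>, necessarily for the first time, and so exclude it.\<close>

lemma card_not_excluded:
  assumes "\<forall>T<2 ^ (Suc n * Suc n). h T \<le> n"
  shows "card {t. t < 2 ^ Suc n \<and> \<not> excluded h n t} \<le> n"
proof (rule ccontr)
  let ?N = "{t. t < 2 ^ Suc n \<and> \<not> excluded h n t}"
  assume "\<not> ?thesis"
  then obtain D where D: "D \<subseteq> ?N" "card D = Suc n"
    using obtain_subset_with_card_n[of "Suc n" ?N] by auto
  then have "finite D" using card.infinite by fastforce
  then obtain d where d: "bij_betw d {..<Suc n} D"
    using ex_bij_betw_nat_finite[of D] D(2) by (auto simp: lessThan_atLeast0)
  have dD: "d j \<in> ?N" if "j < Suc n" for j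
    using bij_betwE[OF d] D(1) that by auto
  then obtain T where T: "T < 2 ^ (Suc n * Suc n)" "\<forall>j<Suc n. digit n T j = d j"
    using ex_digits[of "Suc n" d n] by auto
  have h: "h T \<le> n" using assms T(1) by blast
  have "d j \<noteq> d (h T)" if "j < h T" for j
    using inj_onD[OF bij_betw_imp_inj_on[OF d], of j "h T"] h that by auto
  with T h have "excluded h n (d (h T))"
    unfolding excluded_def by (intro exI[of _ T]) auto
  with dD[of "h T"] h show False by simp
qed

text \<open>Each of the \<open>c\<close> ranks leaves at most \<open>n\<close> blocks, and for
  positive \<open>c\<close> the total \<open>c * n\<close> is less than \<open>c * Suc n\<close>,
  hence than the number \<open>2 ^ Suc n\<close> of blocks.\<close>

lemma ex_excluded_for_all:
  assumes h: "\<forall>i<c. \<forall>T<2 ^ (Suc n * Suc n). h i T \<le> n" and c: "c * Suc n \<le> 2 ^ Suc n"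
  shows "\<exists>t<2 ^ Suc n. \<forall>i<c. excluded (h i) n t"
proof (rule ccontr)
  assume "\<not> ?thesis"
  then have "{..<2 ^ Suc n} \<subseteq> (\<Union>i<c. {t. t < 2 ^ Suc n \<and> \<not> excluded (h i) n t})"
    by auto
  then have "card {..<(2::nat) ^ Suc n} \<le> card (\<Union>i<c. {t. t < 2 ^ Suc n \<and> \<not> excluded (h i) n t})"
    by (intro card_mono) auto
  also have "\<dots> \<le> (\<Sum>i<c. card {t. t < 2 ^ Suc n \<and> \<not> excluded (h i) n t})"
    by (intro card_UN_le) simp
  also have "\<dots> \<le> (\<Sum>i<c. n)"
    using h by (intro sum_mono card_not_excluded) auto
  also have "\<dots> = c * n" by simp
  finally have "2 ^ Suc n \<le> c * n" by simp
  moreover from this have "0 < c" by (cases c) auto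
  ultimately show False using c by simp
qed

section \<open>Queries to the oracle\<close>

lemma computable_div [computable_intros]:
  assumes "computable A k f" "computable A k g"
  shows "computable A k (\<lambda>xs. f xs div g xs)"
proof -
  have "m div n = (LEAST q. n = 0 \<or> m < n * Suc q)" for m n :: nat
  proof (rule Least_equality[symmetric])
    show "n = 0 \<or> m < n * Suc (m div n)"
      using dividend_less_times_div[of n m] by auto
    show "m div n \<le> q" if "n = 0 \<or> m < n * Suc q" for q
      using that less_mult_imp_div_less[of m "Suc q" n] by (auto simp: mult.commute)
  qed
  moreover have "computable A k (\<lambda>xs. LEAST q. g xs = 0 \<or> f xs < g xs * Suc q)"
  proof (rule computable_comp2[OF _ assms])
    have "\<exists>q. n = 0 \<or> m < n * Suc q" for m n :: nat
      using dividend_less_times_div[of n m] by (intro exI[of _ "m div n"]) auto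
    then show "computable A 2 (\<lambda>xs. LEAST q. xs ! 1 = 0 \<or> xs ! 0 < xs ! 1 * Suc q)"
      by (intro computable_intros; simp)
  qed
  ultimately show ?thesis by simp
qed

lemma computable_mod [computable_intros]:
  assumes "computable A k f" "computable A k g"
  shows "computable A k (\<lambda>xs. f xs mod g xs)"
  unfolding minus_mult_div_eq_mod[symmetric] by (intro computable_intros assms)

lemma computable_min [computable_intros]:
  assumes "computable A k f" "computable A k g"
  shows "computable A k (\<lambda>xs. min (f xs) (g xs))"
  unfolding min_def by (intro computable_intros assms)

lemma computable_triangle [computable_intros]:
  assumes "computable A k f"
  shows "computable A k (\<lambda>xs. triangle (f xs))"
  unfolding triangle_def by (intro computable_intros assms)

lemma computable_code_length [computable_intros]:
  assumes "computable A k f"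
  shows "computable A k (\<lambda>xs. code_length (f xs))"
proof (rule computable_comp1[OF _ assms])
  have "\<exists>l. Suc x < 2 * 2 ^ l" for x
    using string_code_bounds(2) surj_string_code by metis
  then show "computable A 1 (\<lambda>xs. code_length (xs ! 0))"
    unfolding code_length_def by (intro computable_intros; simp)
qed

lemma computable_weight [computable_intros]:
  assumes "computable A k f" "computable A k g" "computable A k h"
  shows "computable A k (\<lambda>xs. weight (f xs) (g xs) (h xs))"
  unfolding weight_def compatible_def by (intro computable_intros assms)

lemma computable_mass:
  assumes R: "computable A 2 (\<lambda>xs. R (xs ! 0) (xs ! 1))"
    and "computable A k f" "computable A k g" "computable A k h"
  shows "computable A k (\<lambda>xs. mass R (f xs) (g xs) (h xs))"
proof (rule computable_comp3[OF _ assms(2-)])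
  show "computable A 3 (\<lambda>xs. mass R (xs ! 0) (xs ! 1) (xs ! 2))"
    unfolding mass_def by (intro computable_intros computable_comp2[OF R]; simp)
qed

lemma decidable_heavy_child:
  assumes R: "computable A 2 (\<lambda>xs. R (xs ! 0) (xs ! 1))"
    and "computable A k s" "computable A k n" "computable A k v" "computable A k t"
  shows "decidable A k (\<lambda>xs. heavy_child R (s xs) (n xs) (v xs) (t xs))"
  unfolding heavy_child_def heavy_def by (intro computable_intros computable_mass R assms)

lemma decidable_entering:
  assumes R: "computable A 2 (\<lambda>xs. R (xs ! 0) (xs ! 1))"
    and "computable A k n" "computable A k v" "computable A k u"
  shows "decidable A k (\<lambda>xs. entering R (n xs) (v xs) (u xs))"
  unfolding entering_def by (intro computable_intros decidable_heavy_child R assms)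

lemma computable_rank:
  assumes R: "computable A 2 (\<lambda>xs. R (xs ! 0) (xs ! 1))"
    and "computable A k n" "computable A k v" "computable A k u"
  shows "computable A k (\<lambda>xs. rank R (n xs) (v xs) (u xs))"
proof (rule computable_comp3[OF _ assms(2-)])
  show "computable A 3 (\<lambda>xs. rank R (xs ! 0) (xs ! 1) (xs ! 2))"
    unfolding rank_def by (intro computable_intros decidable_entering R; simp)
qed

lemma computable_digit [computable_intros]:
  assumes "computable A k n" "computable A k T" "computable A k j"
  shows "computable A k (\<lambda>xs. digit (n xs) (T xs) (j xs))"
  unfolding digit_def by (intro computable_intros assms)

text \<open>A Cantor pairing of the components would double the length of the code, which must stay
  \<open>3/2 n\<^sup>2 + O(n)\<close>. The level is therefore stored as the 2-adic valuation.\<close>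

definition query_code :: "nat \<Rightarrow> nat \<Rightarrow> nat \<Rightarrow> nat \<Rightarrow> nat" where
  "query_code n v i T = 2 ^ n * Suc (2 * (v + 2 ^ triangle n * (i + 2 ^ Suc n * T)))"

definition query_level :: "nat \<Rightarrow> nat" where
  "query_level x = (LEAST n. x = 0 \<or> x mod 2 ^ Suc n \<noteq> 0)"

definition query_node :: "nat \<Rightarrow> nat" where
  "query_node x = x div 2 ^ Suc (query_level x) mod 2 ^ triangle (query_level x)"

definition query_rank :: "nat \<Rightarrow> nat" where
  "query_rank x = x div 2 ^ Suc (query_level x) div 2 ^ triangle (query_level x)
    mod 2 ^ Suc (query_level x)"

definition query_tuple :: "nat \<Rightarrow> nat" where
  "query_tuple x = x div 2 ^ Suc (query_level x) div 2 ^ triangle (query_level x)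
    div 2 ^ Suc (query_level x)"

lemma query_code_inverse:
  assumes "v < 2 ^ triangle n" "i < 2 ^ Suc n"
  shows "query_level (query_code n v i T) = n" "query_node (query_code n v i T) = v"
    "query_rank (query_code n v i T) = i" "query_tuple (query_code n v i T) = T"
proof -
  let ?y = "v + 2 ^ triangle n * (i + 2 ^ Suc n * T)"
  have x: "query_code n v i T = 2 ^ n + 2 ^ Suc n * ?y"
    by (simp add: query_code_def algebra_simps)
  show level: "query_level (query_code n v i T) = n"
    unfolding query_level_def
  proof (rule Least_equality)
    show "query_code n v i T = 0 \<or> query_code n v i T mod 2 ^ Suc n \<noteq> 0"
      unfolding x mod_mult_self2 by simp
    fix m assume m: "query_code n v i T = 0 \<or> query_code n v i T mod 2 ^ Suc m \<noteq> 0"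
    show "n \<le> m"
    proof (rule ccontr)
      assume "\<not> n \<le> m"
      then have "2 ^ Suc m dvd (2::nat) ^ n"
        by (intro le_imp_power_dvd) simp
      then have "2 ^ Suc m dvd query_code n v i T"
        unfolding query_code_def by (rule dvd_mult2)
      with m show False by (simp add: query_code_def)
    qed
  qed
  have y: "query_code n v i T div 2 ^ Suc n = ?y"
    unfolding x by simp
  show "query_node (query_code n v i T) = v"
    using assms unfolding query_node_def level y by simp
  have z: "?y div 2 ^ triangle n = i + 2 ^ Suc n * T"
    using assms by simp
  show "query_rank (query_code n v i T) = i"
    using assms unfolding query_rank_def level y z by (simp del: power_Suc)
  show "query_tuple (query_code n v i T) = T"
    using assms unfolding query_tuple_def level y z by (simp del: power_Suc)
qed

text \<open>The fields are \<open>n\<close> zeros, a marker bit, the node, the rank and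
  \<open>n + 1\<close> blocks of \<open>n + 1\<close> bits. The exponent equals 3/2 n^2 + 9/2 n +
  3.\<close>

lemma query_code_less:
  assumes "v < 2 ^ triangle n" "i < 2 ^ Suc n" "T < 2 ^ (Suc n * Suc n)"
  shows "query_code n v i T < 2 ^ (n + Suc (triangle n + (Suc n + Suc n * Suc n)))"
proof -
  have "v + 2 ^ triangle n * (i + 2 ^ Suc n * T) < 2 ^ (triangle n + (Suc n + Suc n * Suc n))"
    by (intro block_less assms)
  then have "Suc (2 * (v + 2 ^ triangle n * (i + 2 ^ Suc n * T))) < 2 ^ Suc (triangle n + (Suc n + Suc n * Suc n))"
    by simp
  then show ?thesis
    unfolding query_code_def power_add[of _ n] by (rule mult_strict_left_mono) simp
qed

lemma computable_query_code [computable_intros]: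
  assumes "computable A k n" "computable A k v" "computable A k i" "computable A k T"
  shows "computable A k (\<lambda>xs. query_code (n xs) (v xs) (i xs) (T xs))"
  unfolding query_code_def by (intro computable_intros assms)

lemma computable_query_level [computable_intros]:
  assumes "computable A k x"
  shows "computable A k (\<lambda>xs. query_level (x xs))"
proof (rule computable_comp1[OF _ assms])
  have "\<exists>n. x = 0 \<or> x mod 2 ^ Suc n \<noteq> 0" for x :: nat
  proof -
    have "x < 2 ^ Suc x"
      using less_exp[of x] unfolding power_Suc by linarith
    then show ?thesis by (intro exI[of _ x]) (auto simp del: power_Suc)
  qed
  then show "computable A 1 (\<lambda>xs. query_level (xs ! 0))"
    unfolding query_level_def by (intro computable_intros; simp del: power_Suc)
qed

lemma computable_query_parts [computable_intros]:
  assumes "computable A k x"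
  shows "computable A k (\<lambda>xs. query_node (x xs))" "computable A k (\<lambda>xs. query_rank (x xs))"
    "computable A k (\<lambda>xs. query_tuple (x xs))"
  unfolding query_node_def query_rank_def query_tuple_def by (intro computable_intros assms)+

section \<open>The diagonal function\<close>

definition hit :: "(nat \<Rightarrow> nat \<Rightarrow> nat) \<Rightarrow> nat \<Rightarrow> nat \<Rightarrow> bool" where
  "hit R u x \<longleftrightarrow> entering R (query_level x) (query_node x) u
    \<and> rank R (query_level x) (query_node x) u = query_rank x
    \<and> (\<exists>j<Suc (query_level x).
        digit (query_level x) (query_tuple x) j = u mod 2 ^ Suc (query_level x))"

definition position :: "nat \<Rightarrow> nat \<Rightarrow> nat" where
  "position u x = (LEAST j. query_level x < j
    \<or> digit (query_level x) (query_tuple x) j = u mod 2 ^ Suc (query_level x))"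

text \<open>Undefined if the rank is never reached, or if the child of that rank is missing from the
  tuple. By \<open>entering_unique\<close> at most one \<open>u\<close> is a hit, so the least one
  involves no choice.\<close>

definition diagonal :: "(nat \<Rightarrow> nat \<Rightarrow> nat) \<Rightarrow> nat \<rightharpoonup> nat" where
  "diagonal R x = (if \<exists>u. hit R u x then Some (position (LEAST u. hit R u x) x) else None)"

lemma partial_recursive_diagonal:
  assumes R: "computable (\<lambda>_. 0) 2 (\<lambda>xs. R (xs ! 0) (xs ! 1))"
  shows "partial_recursive (diagonal R)"
  unfolding diagonal_def
proof (rule partial_recursive_search)
  show "decidable (\<lambda>_. 0) 2 (\<lambda>xs. hit R (xs ! 0) (xs ! 1))"
    unfolding hit_def by (intro computable_intros decidable_entering computable_rank R; simp)
  show "computable (\<lambda>_. 0) 2 (\<lambda>xs. position (xs ! 0) (xs ! 1))"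
    unfolding position_def by (intro computable_intros; (simp; fail | blast intro: lessI))
qed

section \<open>The path of light nodes computed from the oracle\<close>

text \<open>The numbers \<open>a\<close> and \<open>b\<close> translate queries to the diagonal
  function into arguments of the universal one. The disjunct \<open>2 ^ Suc n \<le> t\<close> makes
  the search total for arbitrary \<open>Y\<close> and \<open>v\<close>.\<close>

definition next_node :: "(nat \<Rightarrow> nat) \<Rightarrow> nat \<Rightarrow> nat \<Rightarrow> nat \<Rightarrow> nat \<Rightarrow> nat" where
  "next_node Y a b n v = v + 2 ^ triangle n * (LEAST t. 2 ^ Suc n \<le> t
    \<or> (\<forall>i<2 ^ Suc n div Suc n. excluded (\<lambda>T. Y (a * query_code n v i T + b)) n t))"

definition node :: "(nat \<Rightarrow> nat) \<Rightarrow> nat \<Rightarrow> nat \<Rightarrow> nat \<Rightarrow> nat \<Rightarrow> nat \<Rightarrow> nat" where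
  "node Y a b m v k = rec_nat v (\<lambda>j. next_node Y a b (m + j)) k"

lemma computable_node:
  assumes "computable Y k f"
  shows "computable Y k (\<lambda>xs. node Y a b m v (f xs))"
proof -
  have step: "computable Y 2 (\<lambda>xs. next_node Y a b (xs ! 0) (xs ! 1))"
    unfolding next_node_def excluded_def
    by (intro computable_intros computable_oracle;
        (simp add: computable_drop_nth; fail | blast intro: order_refl))
  show ?thesis
    unfolding node_def
    by (intro computable_intros computable_comp2[where g = "next_node Y a b", OF step] assms; simp)
qed

text \<open>Suppose that the chosen child becomes heavy and is e_i. Exclusion for rank i gives a
  tuple in which its first position is the answer of \<open>Y\<close>; this is also the value of
  \<open>diagonal R\<close> at the query, which \<open>Y\<close> avoids.\<close>

lemma (in enumeration) light_next_node:
  assumes light: "light n v"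
    and avoid: "\<And>x. diagonal R x \<noteq> Some (Y (a * x + b))"
    and bound: "\<And>i T. i < 2 ^ Suc n \<Longrightarrow> T < 2 ^ (Suc n * Suc n) \<Longrightarrow> Y (a * query_code n v i T + b) \<le> n"
  shows "light (Suc n) (next_node Y a b n v)"
proof -
  let ?c = "2 ^ Suc n div Suc n"
  let ?h = "\<lambda>i T. Y (a * query_code n v i T + b)"
  let ?P = "\<lambda>t. 2 ^ Suc n \<le> t \<or> (\<forall>i<?c. excluded (?h i) n t)"
  have v: "v < 2 ^ triangle n"
    using light unfolding light_def by simp
  \<comment> \<open>All ranks in question fit into the \<open>Suc n\<close> bits that a query
    reserves for them.\<close>
  have c: "i < 2 ^ Suc n" if "i < ?c" for i
    using that div_le_dividend[of "2 ^ Suc n" "Suc n"] by (rule less_le_trans)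
  have "\<exists>t<2 ^ Suc n. \<forall>i<?c. excluded (?h i) n t"
  proof (rule ex_excluded_for_all)
    show "\<forall>i<?c. \<forall>T<2 ^ (Suc n * Suc n). ?h i T \<le> n"
      using bound c by blast
    show "?c * Suc n \<le> 2 ^ Suc n"
      by (rule div_times_less_eq_dividend)
  qed
  then obtain t' where t': "t' < 2 ^ Suc n" "?P t'"
    by blast
  define t where "t = (LEAST t. ?P t)"
  have less: "t < 2 ^ Suc n"
    using Least_le[of ?P, OF t'(2)] t'(1) unfolding t_def by (rule le_less_trans)
  have "?P t"
    unfolding t_def by (rule LeastI[of ?P, OF t'(2)])
  with less have ex: "\<And>i. i < ?c \<Longrightarrow> excluded (?h i) n t"
    by (meson not_le)
  have "light (Suc n) (v + 2 ^ triangle n * t)"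
  proof (rule light_child_if_not_heavy[OF light less])
    fix s
    show "\<not> heavy_child R s n v t"
    proof
      assume "heavy_child R s n v t"
      then obtain u where u: "entering R n v u" "u mod 2 ^ Suc n = t" "rank R n v u < ?c"
        using ex_entering[OF light less] by blast
      define i where "i = rank R n v u"
      have i: "i < ?c" "i < 2 ^ Suc n"
        using u(3) c unfolding i_def by blast+
      obtain T where T: "T < 2 ^ (Suc n * Suc n)" "digit n T (?h i T) = t" "\<forall>j<?h i T. digit n T j \<noteq> t"
        using ex[OF i(1)] unfolding excluded_def by blast
      define x where "x = query_code n v i T"
      have le: "Y (a * x + b) \<le> n"
        unfolding x_def by (rule bound[OF i(2) T(1)])
      note x = query_code_inverse[OF v i(2), of T, folded x_def]
      have hit: "hit R u x"
        unfolding hit_def x using u le T(2) unfolding i_def[symmetric] x_def[symmetric]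
        by (auto intro!: exI[of _ "Y (a * x + b)"])
      have "(LEAST u. hit R u x) = u"
      proof (rule Least_equality)
        show "hit R u x" by (rule hit)
        fix u' assume "hit R u' x"
        then have "u' = u"
          using u(1) unfolding hit_def x i_def by (auto intro: entering_unique)
        then show "u \<le> u'" by simp
      qed
      moreover have "position u x = Y (a * x + b)"
        unfolding position_def x u(2)
      proof (rule Least_equality)
        show "n < Y (a * x + b) \<or> digit n T (Y (a * x + b)) = t"
          using T(2) unfolding x_def by blast
        show "Y (a * x + b) \<le> j" if "n < j \<or> digit n T j = t" for j
        proof (rule ccontr)
          assume "\<not> ?thesis"
          then have "j < Y (a * x + b)" by simp
          moreover from this have "digit n T j \<noteq> t"
            using T(3) unfolding x_def by blast
          ultimately show False
            using that le by simp
        qed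
      qed
      moreover have "\<exists>u. hit R u x"
        using hit ..
      ultimately have "diagonal R x = Some (Y (a * x + b))"
        by (simp add: diagonal_def)
      with avoid show False by blast
    qed
  qed
  then show ?thesis
    unfolding next_node_def t_def .
qed

lemma next_node_mod:
  assumes "m \<le> triangle n"
  shows "next_node Y a b n v mod 2 ^ m = v mod 2 ^ m"
proof -
  obtain d where "triangle n = m + d"
    using assms le_Suc_ex by blast
  then show ?thesis
    unfolding next_node_def by (simp add: power_add mult.assoc)
qed

lemma triangle_mono: "m \<le> n \<Longrightarrow> triangle m \<le> triangle n"
  unfolding triangle_def by (intro div_le_mono mult_le_mono) simp_all

text \<open>A step from level n only appends bits from position \<open>triangle n\<close> on, so the
  bits below are final.\<close>

lemma node_mod:
  assumes "m \<le> triangle (n + k)" "k \<le> k'"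
  shows "node Y a b n v k' mod 2 ^ m = node Y a b n v k mod 2 ^ m"
  using assms(2)
proof (induction k' rule: dec_induct)
  case (step k')
  have "m \<le> triangle (n + k')"
    using assms(1) triangle_mono[of "n + k" "n + k'"] step.hyps(1) by simp
  then have "node Y a b n v (Suc k') mod 2 ^ m = node Y a b n v k' mod 2 ^ m"
    using next_node_mod unfolding node_def by simp
  with step.IH show ?case by simp
qed simp

section \<open>Complexity of the sequence\<close>

lemma string_code_unary: "string_code (replicate k True @ [False]) + 2 = 3 * 2 ^ k"
  by (induction k) auto

lemma prefix_unary:
  "prefix (replicate k True @ [False]) (replicate j True @ [False]) \<Longrightarrow> k = j"
proof (induction k arbitrary: j)
  case 0
  then show ?case by (cases j) auto
next
  case (Suc k)
  from Suc.prems obtain i where j: "j = Suc i" "prefix (replicate k True @ [False]) (replicate i True @ [False])"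
    by (cases j) simp_all
  from Suc.IH[OF j(2)] j(1) show ?case by simp
qed

text \<open>\<open>LEAST\<close> in \<open>K\<close> is meaningful only for outputs of
  \<open>U\<close>. Every string is one, since \<open>U\<close> simulates the prefix-free machine
  that maps 1^k 0 to the string with code k.\<close>

lemma universal_surj:
  assumes "universal_prefix_free_machine U"
  shows "\<exists>\<tau>. U \<tau> = Some \<sigma>"
proof -
  \<comment> \<open>By \<open>string_code_unary\<close> this recovers k from the code of 1^k
    0.\<close>
  define \<theta> where "\<theta> x = (if \<exists>k. 3 * 2 ^ k = x + 2 then Some (LEAST k. 3 * 2 ^ k = x + 2) else None)"
    for x :: nat
  define M where "M \<tau> = map_option (inv string_code) (\<theta> (string_code \<tau>))" for \<tau>
  have surj: "surj string_code"
    using surj_string_code by (metis surjI)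
  have dom: "\<exists>k. \<tau> = replicate k True @ [False]" if "\<tau> \<in> dom M" for \<tau>
  proof -
    have "\<theta> (string_code \<tau>) \<noteq> None"
      using that unfolding M_def by auto
    then obtain k where "3 * 2 ^ k = string_code \<tau> + 2"
      unfolding \<theta>_def by presburger
    then have "string_code \<tau> = string_code (replicate k True @ [False])"
      using string_code_unary[of k] by simp
    then show ?thesis using string_code_inject by blast
  qed
  have "partial_recursive \<theta>"
    unfolding \<theta>_def
    by (rule partial_recursive_search[where F = "\<lambda>u x. u"]) (intro computable_intros; simp)+
  moreover have "\<theta> (string_code \<tau>) = map_option string_code (M \<tau>)" for \<tau>
    unfolding M_def by (simp add: option.map_comp comp_def surj_f_inv_f[OF surj] option.map_ident)
  ultimately have "partial_recursive_string M"
    unfolding partial_recursive_string_def by blast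
  then have "prefix_free_machine M"
    unfolding prefix_free_machine_def using dom prefix_unary by metis
  then obtain \<rho> where \<rho>: "\<And>\<tau>. U (\<rho> @ \<tau>) = M \<tau>"
    using assms unfolding universal_prefix_free_machine_def by blast
  let ?k = "string_code \<sigma>"
  have "\<theta> (string_code (replicate ?k True @ [False])) = Some ?k"
    unfolding \<theta>_def string_code_unary by (auto intro: Least_equality)
  moreover have "inv string_code ?k = \<sigma>"
    using string_code_inject by (intro inv_f_f injI)
  ultimately have "M (replicate ?k True @ [False]) = Some \<sigma>"
    unfolding M_def by simp
  with \<rho> show ?thesis by metis
qed

lemma K_attained:
  assumes "universal_prefix_free_machine U"
  obtains \<tau> where "U \<tau> = Some \<sigma>" "length \<tau> = K U \<sigma>"
proof -
  obtain \<tau> where "U \<tau> = Some \<sigma>"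
    using universal_surj[OF assms] by blast
  then have "\<exists>\<tau>'. U \<tau>' = Some \<sigma> \<and> length \<tau>' = length \<tau>" by blast
  then have "\<exists>\<tau>. U \<tau> = Some \<sigma> \<and> length \<tau> = K U \<sigma>"
    unfolding K_def by (rule LeastI)
  with that show thesis by blast
qed

section \<open>Asymptotic estimates\<close>

lemma real_triangle: "real (triangle n) = real n * (real n + 1) / 2"
proof -
  have "2 * triangle n = n * Suc n"
    unfolding triangle_def by simp
  then have "2 * real (triangle n) = real n * (real n + 1)"
    by (metis of_nat_Suc of_nat_mult of_nat_numeral add.commute)
  then show ?thesis by simp
qed

text \<open>By \<open>query_code_less\<close> a code has at most 3/2 n^2 + 9/2 n + 3 bits;
  \<epsilon> n^2 absorbs the linear rest together with \<open>a\<close> and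
  \<open>b\<close>.\<close>

lemma query_code_growth:
  fixes \<epsilon> :: real
  assumes "0 < \<epsilon>"
  shows "\<forall>\<^sub>F n in sequentially. \<forall>v i T. v < 2 ^ triangle n \<longrightarrow> i < 2 ^ Suc n \<longrightarrow> T < 2 ^ (Suc n * Suc n) \<longrightarrow>
    real (a * query_code n v i T + b) \<le> 2 powr ((3/2 + \<epsilon>) * (real n)\<^sup>2)"
proof -
  have ev: "\<forall>\<^sub>F n in sequentially. real (a + b) + 9/2 * real n + 3 \<le> \<epsilon> * (real n)\<^sup>2"
    using assms by real_asymp
  show ?thesis
    using ev
  proof eventually_elim
    case (elim n)
    let ?e = "n + Suc (triangle n + (Suc n + Suc n * Suc n))"
    have e: "real ?e = 3/2 * (real n)\<^sup>2 + 9/2 * real n + 3"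
      by (simp add: real_triangle power2_eq_square field_simps)
    show ?case
    proof (intro allI impI)
      fix v i T :: nat
      assume "v < 2 ^ triangle n" "i < 2 ^ Suc n" "T < 2 ^ (Suc n * Suc n)"
      then have "query_code n v i T \<le> 2 ^ ?e"
        by (intro less_imp_le query_code_less)
      then have "a * query_code n v i T + b \<le> a * 2 ^ ?e + b * 2 ^ ?e"
        by (intro add_mono mult_le_mono2) auto
      also have "\<dots> \<le> 2 ^ (a + b) * 2 ^ ?e"
        using less_exp[of "a + b"] by (simp flip: add_mult_distrib)
      also have "\<dots> = 2 ^ (a + b + ?e)"
        by (simp only: power_add)
      finally have "real (a * query_code n v i T + b) \<le> real (2 ^ (a + b + ?e))"
        by (rule of_nat_mono)
      also have "\<dots> = 2 powr (real (a + b) + real ?e)"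
        by (simp only: of_nat_power of_nat_numeral flip: powr_realpow of_nat_add)
      also have "\<dots> \<le> 2 powr ((3/2 + \<epsilon>) * (real n)\<^sup>2)"
        using elim e by (intro powr_mono) (auto simp: algebra_simps)
      finally show "real (a * query_code n v i T + b) \<le> 2 powr ((3/2 + \<epsilon>) * (real n)\<^sup>2)" .
    qed
  qed
qed

text \<open>Reaching length \<open>m\<close> takes about sqrt(2m) blocks, and with that many the
  loss N log N is about sqrt(m) log m / sqrt(2).\<close>

lemma loss_bound:
  fixes \<alpha> :: real
  assumes "1 \<le> \<alpha>"
  shows "\<forall>\<^sub>F m in sequentially. \<exists>N. n \<le> N \<and> 0 < N \<and> m \<le> triangle N
    \<and> 1 + real N * log 2 (real N) \<le> \<alpha> * sqrt (real m) * log 2 (real m)"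
proof -
  \<comment> \<open>With 3/2 in place of sqrt(2) the leading coefficient on the left is 3/4, still
    less than 1.\<close>
  have "\<forall>\<^sub>F m in sequentially. ln 2 + (3/2 * sqrt (real m) + 1) * ln (3/2 * sqrt (real m) + 1)
      \<le> sqrt (real m) * ln (real m)"
    by real_asymp
  moreover have "\<forall>\<^sub>F m in sequentially. real n \<le> sqrt (2 * real m)"
    by real_asymp
  moreover have "\<forall>\<^sub>F m in sequentially. 0 < m"
    by (rule eventually_gt_at_top)
  ultimately show ?thesis
  proof eventually_elim
    case (elim m)
    define N where "N = nat \<lceil>sqrt (2 * real m)\<rceil>"
    have lower: "sqrt (2 * real m) \<le> real N"
      unfolding N_def by linarith
    have "sqrt 2 \<le> 3/2"
      by (rule real_le_lsqrt) (simp_all add: power2_eq_square)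
    then have "sqrt (2 * real m) \<le> 3/2 * sqrt (real m)"
      unfolding real_sqrt_mult by (intro mult_right_mono) auto
    moreover have "real N \<le> sqrt (2 * real m) + 1"
      unfolding N_def using real_nat_ceiling_ge of_int_ceiling_le_add_one[of "sqrt (2 * real m)"]
      by (simp add: of_nat_nat)
    ultimately have upper: "real N \<le> 3/2 * sqrt (real m) + 1"
      by linarith
    have "0 < sqrt (2 * real m)"
      using elim(3) by simp
    then have N: "0 < N"
      using lower by (cases N) auto
    have "2 * real m \<le> (real N)\<^sup>2"
      using lower real_le_lsqrt real_sqrt_le_iff sqrt_le_D by blast
    then have "real m \<le> real (triangle N)"
      unfolding real_triangle by (simp add: power2_eq_square field_simps)
    moreover have "1 + real N * log 2 (real N) \<le> sqrt (real m) * log 2 (real m)"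
    proof -
      have "real N * ln (real N) \<le> (3/2 * sqrt (real m) + 1) * ln (3/2 * sqrt (real m) + 1)"
        using upper N by (intro mult_mono) auto
      with elim(1) have "ln 2 + real N * ln (real N) \<le> sqrt (real m) * ln (real m)"
        by linarith
      then have "(ln 2 + real N * ln (real N)) / ln 2 \<le> (sqrt (real m) * ln (real m)) / ln 2"
        by (rule divide_right_mono) simp
      then show ?thesis
        by (simp add: log_def add_divide_distrib)
    qed
    moreover have "1 * (sqrt (real m) * log 2 (real m)) \<le> \<alpha> * (sqrt (real m) * log 2 (real m))"
      using assms elim(3) by (intro mult_right_mono) auto
    ultimately show ?case
      using elim(2) lower N by (intro exI[of _ N]) (auto simp: mult.assoc)
  qed
qed

section \<open>The reduction\<close>

lemma complex_if_avoids:
  fixes \<epsilon> \<alpha> :: real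
  assumes U: "universal_prefix_free_machine U" and \<psi>: "linearly_universal \<psi>"
    and avoid: "\<And>n. \<psi> n \<noteq> Some (Y n)" and "1 \<le> \<alpha>" "0 < \<epsilon>"
    and growth: "\<forall>\<^sub>F n in sequentially. \<forall>x. real x \<le> 2 powr ((3/2 + \<epsilon>) * (real n)\<^sup>2) \<longrightarrow> Y x \<le> n"
  shows "\<exists>X\<in>COMPLEX U (\<lambda>n. real n - \<alpha> * sqrt (real n) * log 2 (real n)). recursive_in Y X"
proof -
  have pf: "prefix_free_machine U"
    using U unfolding universal_prefix_free_machine_def by blast
  then obtain \<theta> where "partial_recursive \<theta>"
    and \<theta>: "\<And>\<sigma>. \<theta> (string_code \<sigma>) = map_option string_code (U \<sigma>)"
    unfolding prefix_free_machine_def partial_recursive_string_def by blast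
  then obtain p where p: "\<And>x y. eval (\<lambda>_. 0) p [x] y \<longleftrightarrow> \<theta> x = Some y"
    unfolding partial_recursive_def by blast
  define R where "R s x = staged (\<lambda>_. 0) p s [x]" for s x
  have R: "(\<exists>s. R s x = Suc y) \<longleftrightarrow> \<theta> x = Some y" for x y
    using p[of x y] unfolding R_def eval_iff_staged .
  have dom: "\<sigma> \<in> dom U" if nonzero: "R s (string_code \<sigma>) \<noteq> 0" for s \<sigma>
  proof -
    obtain y where "R s (string_code \<sigma>) = Suc y"
      using nonzero by (cases "R s (string_code \<sigma>)") auto
    then have "\<theta> (string_code \<sigma>) = Some y"
      using R[of "string_code \<sigma>" y] by blast
    then show ?thesis
      unfolding \<theta> by auto
  qed

  interpret prefix_free_enumeration R
  proof
    show "R s' x = Suc y" if "R s x = Suc y" "s \<le> s'" for s x y s'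
      using that unfolding R_def by (rule staged_mono)
    show "\<sigma> = \<tau>" if "R s (string_code \<sigma>) \<noteq> 0" "R s (string_code \<tau>) \<noteq> 0" "prefix \<sigma> \<tau>" for s \<sigma> \<tau>
      using pf dom[OF that(1)] dom[OF that(2)] that(3) unfolding prefix_free_machine_def by metis
  qed
  have "partial_recursive (diagonal R)"
    unfolding R_def by (rule partial_recursive_diagonal) (rule computable_staged_unary)
  then obtain a b where "\<And>x. \<psi> (a * x + b) = diagonal R x"
    using \<psi> unfolding linearly_universal_def by blast
  with avoid have diag: "\<And>x. diagonal R x \<noteq> Some (Y (a * x + b))"
    by metis
  have "\<forall>\<^sub>F n in sequentially. \<forall>v i T. v < 2 ^ triangle n \<longrightarrow> i < 2 ^ Suc n \<longrightarrow> T < 2 ^ (Suc n * Suc n) \<longrightarrow>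
      Y (a * query_code n v i T + b) \<le> n"
    using query_code_growth[OF \<open>0 < \<epsilon>\<close>, of a b] growth by eventually_elim blast
  then obtain n where n: "\<And>k v i T. n \<le> k \<Longrightarrow> v < 2 ^ triangle k \<Longrightarrow> i < 2 ^ Suc k \<Longrightarrow>
      T < 2 ^ (Suc k * Suc k) \<Longrightarrow> Y (a * query_code k v i T + b) \<le> k"
    unfolding eventually_sequentially by blast
  obtain v where v: "light n v"
    using ex_light by blast
  define V where "V = node Y a b n v"
  have light: "light (n + k) (V k)" for k
  proof (induction k)
    case 0
    then show ?case using v by (simp add: V_def node_def)
  next
    case (Suc k)
    then have "V k < 2 ^ triangle (n + k)"
      unfolding light_def by simp
    then have "light (Suc (n + k)) (next_node Y a b (n + k) (V k))"
      by (intro light_next_node Suc.IH diag n) simp_all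
    then show ?case by (simp add: V_def node_def)
  qed
  \<comment> \<open>After \<open>Suc m\<close> further blocks at least \<open>m + 1\<close> bits are
    settled, so bit \<open>m\<close> is final.\<close>
  define X where "X m = odd (V (Suc m) div 2 ^ m)" for m
  have "recursive_in Y (\<lambda>m. V (Suc m) div 2 ^ m mod 2)"
    unfolding V_def by (intro recursive_in_if_computable computable_intros computable_node; simp)
  also have "(\<lambda>m. V (Suc m) div 2 ^ m mod 2) = (\<lambda>m. of_bool (X m))"
    unfolding X_def by (auto simp: mod2_eq_if)
  finally have rec: "recursive_in Y (\<lambda>m. of_bool (X m))" .
  have mod: "V k mod 2 ^ m = V k' mod 2 ^ m"
    if "m \<le> triangle (n + k)" "m \<le> triangle (n + k')" for k k' m
    using node_mod[of m n k k' Y a b v] node_mod[of m n k' k Y a b v] that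
    unfolding V_def by (cases "k \<le> k'") auto
  have X: "Suc (string_code (map X [0..<m])) = 2 ^ m + V k mod 2 ^ m" if "m \<le> triangle (n + k)" for m k
  proof -
    have "X i = odd (V k div 2 ^ i)" if "i < m" for i
    proof -
      have le: "Suc i \<le> triangle (n + Suc i)"
        using triangle_mono[of "Suc i" "n + Suc i"] by simp
      have "V (Suc i) mod 2 ^ Suc i = V k mod 2 ^ Suc i"
        by (rule mod[OF le]) (use that \<open>m \<le> triangle (n + k)\<close> in simp)
      then have "take_bit (Suc i) (V (Suc i)) = take_bit (Suc i) (V k)"
        by (simp only: take_bit_eq_mod)
      then have "bit (V (Suc i)) i = bit (V k) i"
        by (metis bit_take_bit_iff lessI)
      then show ?thesis
        unfolding X_def bit_iff_odd .
    qed
    then have "map X [0..<m] = map (\<lambda>i. odd (V k div 2 ^ i)) [0..<m]"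
      by simp
    then show ?thesis
      by (simp only: string_code_prefix)
  qed
  define f where "f m = real m - \<alpha> * sqrt (real m) * log 2 (real m)" for m
  obtain M where M: "\<And>m. M \<le> m \<Longrightarrow> \<exists>N. n \<le> N \<and> 0 < N \<and> m \<le> triangle N
    \<and> 1 + real N * log 2 (real N) \<le> \<alpha> * sqrt (real m) * log 2 (real m)"
    using loss_bound[OF \<open>1 \<le> \<alpha>\<close>, of n] unfolding eventually_sequentially by blast
  have large: "f m \<le> real (K U (map X [0..<m]))" if "M \<le> m" for m
  proof -
    obtain N where N: "n \<le> N" "0 < N" "m \<le> triangle N"
      "1 + real N * log 2 (real N) \<le> \<alpha> * sqrt (real m) * log 2 (real m)"
      using M[OF \<open>M \<le> m\<close>] by blast
    obtain k where k: "N = n + k"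
      using N(1) le_Suc_ex by blast
    obtain \<tau> where \<tau>: "U \<tau> = Some (map X [0..<m])" "length \<tau> = K U (map X [0..<m])"
      using K_attained[OF U] by blast
    then have "\<theta> (string_code \<tau>) = Some (string_code (map X [0..<m]))"
      by (simp add: \<theta>)
    then obtain s where "R s (string_code \<tau>) = Suc (string_code (map X [0..<m]))"
      using R by blast
    \<comment> \<open>A node of level \<open>N\<close> has at least \<open>m\<close> bits; its
      lightness gives m < length \<tau> + 1 + N log N.\<close>
    from complexity_light[OF light[of k] N(3)[unfolded k] this X]
    have less: "2 ^ m < 2 ^ Suc (length \<tau>) * N ^ N"
      using N(3) unfolding k by simp
    have "real (2 ^ m) \<le> real (2 ^ Suc (length \<tau>) * N ^ N)"
      using less by (intro of_nat_mono less_imp_le)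
    then have "log 2 (2 ^ m) \<le> log 2 (2 ^ Suc (length \<tau>) * real N ^ N)"
      using N(2) by (intro log_mono) auto
    moreover have "log 2 (2 ^ m) = real m"
      by simp
    moreover have "log 2 (2 ^ Suc (length \<tau>) * real N ^ N) = real (Suc (length \<tau>)) + real N * log 2 (real N)"
      using N(2) by (simp add: log_mult log_nat_power del: power_Suc)
    ultimately show ?thesis
      using N(4) \<tau>(2) unfolding f_def by simp
  qed
  \<comment> \<open>Absorbs the finitely many lengths below \<open>M\<close>.\<close>
  define c where "c = nat \<lceil>\<Sum>m<M. \<bar>f m\<bar>\<rceil>"
  have "f m - real c \<le> real (K U (map X [0..<m]))" for m
  proof (cases "M \<le> m")
    case True
    then show ?thesis using large[of m] by simp
  next
    case False
    then have "\<bar>f m\<bar> \<le> (\<Sum>m<M. \<bar>f m\<bar>)"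
      by (intro member_le_sum) auto
    also have "\<dots> \<le> real c"
      unfolding c_def by linarith
    finally show ?thesis by simp
  qed
  then have "(\<lambda>m. of_bool (X m)) \<in> COMPLEX U f"
    unfolding COMPLEX_def by blast
  with rec show ?thesis
    unfolding f_def by blast
qed

text \<open>The strict bound in \<open>LUA\<close> turns \<open>p x \<le> n + 1\<close> into an
  answer of at most \<open>n\<close>, that is, into a position in an (n + 1)-tuple.\<close>

lemma complex_weakly_reducible_LUA:
  fixes p :: "nat \<Rightarrow> real" and \<epsilon> \<alpha> :: real
  assumes "universal_prefix_free_machine U" "1 \<le> \<alpha>" "0 < \<epsilon>"
    and growth: "\<forall>\<^sub>F n in sequentially. \<forall>x\<ge>a. real x \<le> 2 powr ((3/2 + \<epsilon>) * (real n)\<^sup>2) \<longrightarrow> p x \<le> real n + 1"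
  shows "COMPLEX U (\<lambda>n. real n - \<alpha> * sqrt (real n) * log 2 (real n)) \<le>\<^sub>w LUA (constant_below a p)"
  unfolding weakly_reducible_def
proof
  fix Y assume "Y \<in> LUA (constant_below a p)"
  then obtain \<psi> where Y: "\<And>n. real (Y n) < constant_below a p n"
    and \<psi>: "linearly_universal \<psi>" "\<And>n. \<psi> n \<noteq> Some (Y n)"
    unfolding LUA_def by blast
  \<comment> \<open>Below \<open>a\<close> all bounds equal \<open>p a\<close>, which
    \<open>n + 1\<close> eventually dominates.\<close>
  have "\<forall>\<^sub>F n in sequentially. p a \<le> real n + 1"
    by real_asymp
  with growth have "\<forall>\<^sub>F n in sequentially. \<forall>x. real x \<le> 2 powr ((3/2 + \<epsilon>) * (real n)\<^sup>2) \<longrightarrow> Y x \<le> n"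
  proof eventually_elim
    case (elim n)
    show ?case
    proof (intro allI impI)
      fix x assume "real x \<le> 2 powr ((3/2 + \<epsilon>) * (real n)\<^sup>2)"
      with elim have "constant_below a p x \<le> real n + 1"
        unfolding constant_below_def by simp
      with Y[of x] have "real (Y x) < real n + 1"
        by (rule less_le_trans)
      then show "Y x \<le> n" by simp
    qed
  qed
  with assms \<psi> show "\<exists>X\<in>COMPLEX U (\<lambda>n. real n - \<alpha> * sqrt (real n) * log 2 (real n)). recursive_in Y X"
    by (intro complex_if_avoids)
qed

text \<open>At the largest \<open>x\<close> allowed the left side is (2 n^2)^\<beta>, of order n^(2
  \<beta>), and 2 \<beta> < 1.\<close>

lemma log_powr_growth:
  fixes \<beta> :: real
  assumes "0 < \<beta>" "\<beta> < 1/2"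
  shows "\<forall>\<^sub>F n in sequentially. \<forall>x\<ge>a. real x \<le> 2 powr ((3/2 + 1/2) * (real n)\<^sup>2) \<longrightarrow>
    log 2 (real x) powr \<beta> \<le> real n + 1"
proof -
  have "\<forall>\<^sub>F n in sequentially. (2 * (real n)\<^sup>2) powr \<beta> \<le> real n + 1"
    using assms by real_asymp
  then show ?thesis
  proof eventually_elim
    case (elim n)
    show ?case
    proof (intro allI impI)
      fix x assume x: "real x \<le> 2 powr ((3/2 + 1/2) * (real n)\<^sup>2)"
      have "log 2 (real x) powr \<beta> \<le> (2 * (real n)\<^sup>2) powr \<beta>"
      proof (cases "x = 0")
        case False
        then have "log 2 (real x) \<le> log 2 (2 powr (2 * (real n)\<^sup>2))"
          using x by (subst log_le_cancel_iff) auto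
        then show ?thesis
          using assms False by (intro powr_mono2) auto
      \<comment> \<open>At \<open>x = 0\<close> the convention \<open>ln 0 = 0\<close> makes the
        left side 0.\<close>
      qed (simp add: log_def)
      with elim show "log 2 (real x) powr \<beta> \<le> real n + 1"
        by simp
    qed
  qed
qed

text \<open>Transfers the growth condition, stated at real arguments, to the integers below them:
  for monotone \<open>q\<close> the interpolated value is at least the one at the floor.\<close>

lemma piecewise_linear_ge:
  assumes "mono q" "0 \<le> y" "real x \<le> y"
  shows "q x \<le> piecewise_linear q y"
proof -
  have "x \<le> nat \<lfloor>y\<rfloor>"
    using assms(2,3) by (simp add: le_nat_floor)
  then have "q x \<le> q (nat \<lfloor>y\<rfloor>)"
    using assms(1) by (rule monoD[rotated])
  also have "\<dots> \<le> piecewise_linear q y"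
    using monoD[OF assms(1), of "nat \<lfloor>y\<rfloor>" "nat \<lfloor>y\<rfloor> + 1"]
    unfolding piecewise_linear_def by simp
  finally show ?thesis .
qed

theorem mainTheorem15:
  fixes U :: "bool list \<rightharpoonup> bool list" and \<alpha> :: real
  assumes "universal_prefix_free_machine U"
    and "\<alpha> \<in> \<rat>" and "1 < \<alpha>"
  shows
    "(\<forall>\<beta>::real. \<beta> \<in> \<rat> \<and> 0 < \<beta> \<and> \<beta> < 1/2 \<longrightarrow>
        (\<forall>a::nat. (\<forall>n\<ge>a. 1 < log 2 (real n) powr \<beta>) \<longrightarrow>
           COMPLEX U (\<lambda>n. real n - \<alpha> * sqrt (real n) * log 2 (real n))
             \<le>\<^sub>w LUA (constant_below a (\<lambda>n. log 2 (real n) powr \<beta>)))) \<and>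
     (\<forall>q::nat \<Rightarrow> nat. order_function (\<lambda>n. real (q n)) \<and>
        (\<exists>\<epsilon>::real. 0 < \<epsilon> \<and> (\<forall>\<^sub>\<infinity>n::nat.
           piecewise_linear (\<lambda>n. real (q n)) (2 powr ((3/2 + \<epsilon>) * (real n)\<^sup>2)) \<le> real n + 1)) \<longrightarrow>
        (\<forall>a::nat. (\<forall>n\<ge>a. 1 < real (q n)) \<longrightarrow>
           COMPLEX U (\<lambda>n. real n - \<alpha> * sqrt (real n) * log 2 (real n))
             \<le>\<^sub>w LUA (constant_below a (\<lambda>n. real (q n)))))"
proof (intro conjI allI impI)
  fix \<beta> :: real and a :: nat
  assume "\<beta> \<in> \<rat> \<and> 0 < \<beta> \<and> \<beta> < 1/2"
  then show "COMPLEX U (\<lambda>n. real n - \<alpha> * sqrt (real n) * log 2 (real n))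
      \<le>\<^sub>w LUA (constant_below a (\<lambda>n. log 2 (real n) powr \<beta>))"
    \<comment> \<open>The choice 1/2 for \<epsilon> gives the exponent 2 n^2 of
      \<open>log_powr_growth\<close>.\<close>
    using assms(1,3) by (intro complex_weakly_reducible_LUA[where \<epsilon> = "1/2"] log_powr_growth) auto
next
  fix q :: "nat \<Rightarrow> nat" and a :: nat
  assume q: "order_function (\<lambda>n. real (q n)) \<and>
    (\<exists>\<epsilon>::real. 0 < \<epsilon> \<and> (\<forall>\<^sub>\<infinity>n::nat.
      piecewise_linear (\<lambda>n. real (q n)) (2 powr ((3/2 + \<epsilon>) * (real n)\<^sup>2)) \<le> real n + 1))"
  then obtain \<epsilon> :: real where "0 < \<epsilon>" and \<epsilon>: "\<forall>\<^sub>F n in sequentially.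
      piecewise_linear (\<lambda>n. real (q n)) (2 powr ((3/2 + \<epsilon>) * (real n)\<^sup>2)) \<le> real n + 1"
    unfolding cofinite_eq_sequentially by blast
  have mono: "mono (\<lambda>n. real (q n))"
    using q unfolding order_function_def by blast
  from \<epsilon> have "\<forall>\<^sub>F n in sequentially. \<forall>x\<ge>a. real x \<le> 2 powr ((3/2 + \<epsilon>) * (real n)\<^sup>2) \<longrightarrow>
      real (q x) \<le> real n + 1"
  proof eventually_elim
    case (elim n)
    then show ?case
      using piecewise_linear_ge[OF mono, of "2 powr ((3/2 + \<epsilon>) * (real n)\<^sup>2)"]
      by (meson order_trans powr_ge_zero)
  qed
  then show "COMPLEX U (\<lambda>n. real n - \<alpha> * sqrt (real n) * log 2 (real n))
      \<le>\<^sub>w LUA (constant_below a (\<lambda>n. real (q n)))"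
    using assms(1,3) \<open>0 < \<epsilon>\<close> by (intro complex_weakly_reducible_LUA) auto
qed

end
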